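(* Let $\Gamma$ be a (finite, simple, connected) tetravalent graph of girth $5$. Then $\Gamma$ admits a half-arc-transitive subgroup $G\leq \mathrm{Aut}(\Gamma)$ such that, with respect to a $G$-induced orientation of the edges of $\Gamma$, $\Gamma$ has at least one undirected $5$-cycle, if and only if $\Gamma\cong \mathcal{X}_o(3,9;4)$ (the Doyle-Holt graph) or $\Gamma\cong \mathrm{R}_{12}(5,2)$.
   Context: An arc of a graph is an ordered pair of adjacent vertices. A subgroup $G\le\mathrm{Aut}(\Gamma)$ is half-arc-transitive on $\Gamma$ if it acts transitively on the vertex set and on the edge set but not on the arc set. In that case $G$ has exactly two orbits on arcs, each containing exactly one of $(u,v),(v,u)$ for every edge $\{u,v\}$; each of these orbits, viewed as a set of directed edges, is a $G$-induced orientation $\vec\Gamma$ of $\Gamma$ (in the tetravalent case every vertex has two out-neighbours and two in-neighbours). A $5$-cycle $C$ of $\Gamma$ is directed with respect to $\vec\Gamma$ if every vertex of $C$ is the head of one and the tail of the other of the two arcs of $\vec\Gamma$ corresponding to the two edges of $C$ at that vertex; otherwise it is undirected. (This does not depend on which of the two $G$-induced orientations is chosen.) For integers $m\ge3$ and odd $r\ge3$ and $q\in\mathbb{Z}_r$ with $q^m=\pm1$, the graph $\mathcal{X}_o(m,r;q)$ has vertex set $\{u_i^j: i\in\mathbb{Z}_m, j\in\mathbb{Z}_r\}$ and edges given by $u_i^j\sim u_{i+1}^{j\pm q^i}$ ($i\in\mathbb{Z}_m$, $j\in\mathbb{Z}_r$), subscripts mod $m$, superscripts mod $r$. For $n\ge3$,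 $1\le r<n/2$, $1\le a\le n-1$, the Rose window graph $\mathrm{R}_n(a,r)$ has vertex set $\{x_i,y_i: i\in\mathbb{Z}_n\}$ and edges $\{x_i,x_{i+1}\}$, $\{y_i,y_{i+r}\}$, $\{x_i,y_i\}$, $\{x_i,y_{i-a}\}$ for $i\in\mathbb{Z}_n$ (indices mod $n$). *)

theory Defs
  imports
    "Graph_Theory.Pair_Digraph"
    "Graph_Theory.Digraph_Isomorphism"
    "HOL-Algebra.Group_Action"
    "HOL-Library.Extended_Nat"
begin

text \<open>
  A finite simple graph is a \<^locale>\<open>pair_graph\<close>: a finite vertex set with a finite, symmetric,
  irreflexive set \<^const>\<open>parcs\<close> of ordered pairs of adjacent vertices, i.e. of arcs.
\<close>

definition uedges :: "'a pair_pre_digraph \<Rightarrow> 'a set set" where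
  "uedges \<Gamma> = (\<lambda>(u, v). {u, v}) ` parcs \<Gamma>"

definition tetravalent :: "'a pair_pre_digraph \<Rightarrow> bool" where
  "tetravalent \<Gamma> \<longleftrightarrow> (\<forall>v\<in>pverts \<Gamma>. out_degree (with_proj \<Gamma>) v = 4)"

text \<open>
  The library's \<^const>\<open>pre_digraph.cycle\<close> is a notion for digraphs: in a symmetric digraph it also
  admits the closed walks \<open>u, v, u\<close>. These are not cycles of the undirected graph, whence the
  bound on the length.
\<close>

definition ucycle :: "'a pair_pre_digraph \<Rightarrow> ('a \<times> 'a) awalk \<Rightarrow> bool" where
  "ucycle \<Gamma> p \<longleftrightarrow> pre_digraph.cycle (with_proj \<Gamma>) p \<and> 3 \<le> length p"

definition girth :: "'a pair_pre_digraph \<Rightarrow> enat" where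
  "girth \<Gamma> = (INF p\<in>{p. ucycle \<Gamma> p}. enat (length p))"


section \<open>Half-arc-transitive groups of automorphisms\<close>

definition graph_auts :: "'a pair_pre_digraph \<Rightarrow> ('a \<Rightarrow> 'a) set" where
  "graph_auts \<Gamma> = {f \<in> Bij (pverts \<Gamma>).
     \<forall>u\<in>pverts \<Gamma>. \<forall>v\<in>pverts \<Gamma>. (f u, f v) \<in> parcs \<Gamma> \<longleftrightarrow> (u, v) \<in> parcs \<Gamma>}"

definition Aut :: "'a pair_pre_digraph \<Rightarrow> ('a \<Rightarrow> 'a) monoid" where
  "Aut \<Gamma> = BijGroup (pverts \<Gamma>) \<lparr>carrier := graph_auts \<Gamma>\<rparr>"

text \<open>
  The actions on edges and on arcs are restricted because \<^const>\<open>BijGroup\<close>, and therefore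
  \<^locale>\<open>group_action\<close>, deals with extensional functions.
\<close>

definition edge_action :: "'a pair_pre_digraph \<Rightarrow> ('a \<Rightarrow> 'a) \<Rightarrow> 'a set \<Rightarrow> 'a set" where
  "edge_action \<Gamma> g = (\<lambda>e\<in>uedges \<Gamma>. g ` e)"

definition arc_action :: "'a pair_pre_digraph \<Rightarrow> ('a \<Rightarrow> 'a) \<Rightarrow> 'a \<times> 'a \<Rightarrow> 'a \<times> 'a" where
  "arc_action \<Gamma> g = (\<lambda>a\<in>parcs \<Gamma>. (g (fst a), g (snd a)))"

definition half_arc_transitive :: "'a pair_pre_digraph \<Rightarrow> ('a \<Rightarrow> 'a) set \<Rightarrow> bool" where
  "half_arc_transitive \<Gamma> G \<longleftrightarrow>
     subgroup G (Aut \<Gamma>) \<and>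
     transitive_action (Aut \<Gamma> \<lparr>carrier := G\<rparr>) (pverts \<Gamma>) (\<lambda>g. g) \<and>
     transitive_action (Aut \<Gamma> \<lparr>carrier := G\<rparr>) (uedges \<Gamma>) (edge_action \<Gamma>) \<and>
     \<not> transitive_action (Aut \<Gamma> \<lparr>carrier := G\<rparr>) (parcs \<Gamma>) (arc_action \<Gamma>)"

definition induced_orientation ::
    "'a pair_pre_digraph \<Rightarrow> ('a \<Rightarrow> 'a) set \<Rightarrow> ('a \<times> 'a) set \<Rightarrow> bool" where
  "induced_orientation \<Gamma> G D \<longleftrightarrow>
     D \<in> orbits (Aut \<Gamma> \<lparr>carrier := G\<rparr>) (parcs \<Gamma>) (arc_action \<Gamma>)"

text \<open>
  \<open>oriented_arcs D p\<close> consists of the arcs of the orientation \<open>D\<close> that correspond to the edges of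
  the cycle \<open>p\<close>, whichever way \<open>p\<close> traverses them.
\<close>

definition oriented_arcs :: "('a \<times> 'a) set \<Rightarrow> ('a \<times> 'a) awalk \<Rightarrow> ('a \<times> 'a) set" where
  "oriented_arcs D p = D \<inter> (set p)\<^sup>s"

definition directed_cycle :: "('a \<times> 'a) set \<Rightarrow> ('a \<times> 'a) awalk \<Rightarrow> bool" where
  "directed_cycle D p \<longleftrightarrow>
     (\<forall>v\<in>fst ` set p.
        (\<exists>!a. a \<in> oriented_arcs D p \<and> snd a = v) \<and>
        (\<exists>!a. a \<in> oriented_arcs D p \<and> fst a = v))"


section \<open>Two families of graphs\<close>

text \<open>
  \<open>X_o m r q\<close> is meant for \<open>m \<ge> 3\<close>, odd \<open>r \<ge> 3\<close> and \<open>q ^ m \<equiv> \<plusminus> 1 (mod r)\<close>. The pair \<open>(i, j)\<close> is the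
  vertex \<open>u\<^sub>i\<^sup>j\<close>, with residues represented by \<open>0, \<dots>, m - 1\<close> and \<open>0, \<dots>, r - 1\<close>. The condition on
  \<open>q ^ m\<close> makes the set \<open>{q ^ i, - (q ^ i)}\<close> modulo \<open>r\<close> independent of the representative of \<open>i\<close>.
\<close>

definition X_o :: "nat \<Rightarrow> int \<Rightarrow> int \<Rightarrow> (nat \<times> int) pair_pre_digraph" where
  "X_o m r q = \<lparr>
     pverts = {0..<m} \<times> {0..<r},
     parcs = (\<Union>i\<in>{0..<m}. \<Union>j\<in>{0..<r}.
        {((i, j), (Suc i mod m, (j + q ^ i) mod r)),
         ((i, j), (Suc i mod m, (j - q ^ i) mod r))})\<^sup>s \<rparr>"

datatype rose_vertex = Rose_x int | Rose_y int

text \<open>\<open>rose_window n a r\<close> is meant for \<open>n \<ge> 3\<close>, \<open>1 \<le> r < n / 2\<close> and \<open>1 \<le> a \<le> n - 1\<close>.\<close>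

definition rose_window :: "int \<Rightarrow> int \<Rightarrow> int \<Rightarrow> rose_vertex pair_pre_digraph" where
  "rose_window n a r = \<lparr>
     pverts = Rose_x ` {0..<n} \<union> Rose_y ` {0..<n},
     parcs = (\<Union>i\<in>{0..<n}.
        {(Rose_x i, Rose_x ((i + 1) mod n)),
         (Rose_y i, Rose_y ((i + r) mod n)),
         (Rose_x i, Rose_y i),
         (Rose_x i, Rose_y ((i - a) mod n))})\<^sup>s \<rparr>"


section \<open>Adequacy\<close>

text \<open>
  For subgroups of \<^const>\<open>Aut\<close> all three maps are group actions, so a negated
  \<^locale>\<open>transitive_action\<close> does express that some pair of arcs is not connected by the group.
\<close>

lemma graph_autsD:
  assumes "g \<in> graph_auts \<Gamma>"
  shows "bij_betw g (pverts \<Gamma>) (pverts \<Gamma>)" "g \<in> Bij (pverts \<Gamma>)"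
    and "u \<in> pverts \<Gamma> \<Longrightarrow> v \<in> pverts \<Gamma> \<Longrightarrow> (g u, g v) \<in> parcs \<Gamma> \<longleftrightarrow> (u, v) \<in> parcs \<Gamma>"
    and "u \<in> pverts \<Gamma> \<Longrightarrow> g u \<in> pverts \<Gamma>"
  using assms by (simp_all add: graph_auts_def Bij_def) (blast dest: bij_betwE)

lemma subgroup_graph_auts: "subgroup (graph_auts \<Gamma>) (BijGroup (pverts \<Gamma>))"
proof (rule group.subgroupI[OF group_BijGroup])
  show "graph_auts \<Gamma> \<subseteq> carrier (BijGroup (pverts \<Gamma>))"
    by (auto simp: graph_auts_def BijGroup_def)
  have "(\<lambda>x\<in>pverts \<Gamma>. x) \<in> graph_auts \<Gamma>"
    using id_Bij by (auto simp: graph_auts_def)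
  then show "graph_auts \<Gamma> \<noteq> {}" by auto
next
  fix f assume f: "f \<in> graph_auts \<Gamma>"
  note F = graph_autsD[OF f]
  have "(inv_into (pverts \<Gamma>) f u, inv_into (pverts \<Gamma>) f v) \<in> parcs \<Gamma> \<longleftrightarrow> (u, v) \<in> parcs \<Gamma>"
    if "u \<in> pverts \<Gamma>" "v \<in> pverts \<Gamma>" for u v
  proof -
    have img: "f ` pverts \<Gamma> = pverts \<Gamma>"
      using F(1) by (rule bij_betw_imp_surj_on)
    then have "inv_into (pverts \<Gamma>) f w \<in> pverts \<Gamma>" "f (inv_into (pverts \<Gamma>) f w) = w"
      if "w \<in> pverts \<Gamma>" for w
      using that by (simp_all add: inv_into_into f_inv_into_f)
    then show ?thesis
      using F(3)[of "inv_into (pverts \<Gamma>) f u" "inv_into (pverts \<Gamma>) f v"] that by simp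
  qed
  then show "inv\<^bsub>BijGroup (pverts \<Gamma>)\<^esub> f \<in> graph_auts \<Gamma>"
    using F(2) by (simp add: inv_BijGroup graph_auts_def restrict_inv_into_Bij)
next
  fix f g assume "f \<in> graph_auts \<Gamma>" "g \<in> graph_auts \<Gamma>"
  note F = graph_autsD[OF this(1)] and G = graph_autsD[OF this(2)]
  show "f \<otimes>\<^bsub>BijGroup (pverts \<Gamma>)\<^esub> g \<in> graph_auts \<Gamma>"
    unfolding graph_auts_def BijGroup_def
    by (simp add: F(2) G(2) compose_Bij compose_eq F(3) G(3) G(4))
qed

lemma group_Aut: "group (Aut \<Gamma>)"
  unfolding Aut_def
  using subgroup.subgroup_is_group[OF subgroup_graph_auts group_BijGroup] .

lemma Aut_mult:
  assumes "f \<in> graph_auts \<Gamma>" "g \<in> graph_auts \<Gamma>"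
  shows "f \<otimes>\<^bsub>Aut \<Gamma>\<^esub> g = compose (pverts \<Gamma>) f g"
  using assms by (auto simp: Aut_def BijGroup_def graph_auts_def)

lemma group_action_AutI:
  assumes G: "subgroup G (Aut \<Gamma>)"
    and B: "\<And>g. g \<in> graph_auts \<Gamma> \<Longrightarrow> \<phi> g \<in> Bij E"
    and M: "\<And>f g. f \<in> graph_auts \<Gamma> \<Longrightarrow> g \<in> graph_auts \<Gamma> \<Longrightarrow>
               \<phi> (compose (pverts \<Gamma>) f g) = compose E (\<phi> f) (\<phi> g)"
  shows "group_action (Aut \<Gamma>\<lparr>carrier := G\<rparr>) E \<phi>"
proof -
  have sub: "G \<subseteq> graph_auts \<Gamma>"
    using subgroup.subset[OF G] by (simp add: Aut_def)
  show ?thesis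
    unfolding group_action_def group_hom_def group_hom_axioms_def
  proof (intro conjI homI)
    show "Group.group (Aut \<Gamma>\<lparr>carrier := G\<rparr>)" "Group.group (BijGroup E)"
      using subgroup.subgroup_is_group[OF G group_Aut] group_BijGroup by auto
  next
    fix g assume "g \<in> carrier (Aut \<Gamma>\<lparr>carrier := G\<rparr>)"
    then show "\<phi> g \<in> carrier (BijGroup E)"
      using B sub by (auto simp: BijGroup_def)
  next
    fix f g assume "f \<in> carrier (Aut \<Gamma>\<lparr>carrier := G\<rparr>)" "g \<in> carrier (Aut \<Gamma>\<lparr>carrier := G\<rparr>)"
    then have "f \<in> graph_auts \<Gamma>" "g \<in> graph_auts \<Gamma>" using sub by auto
    then show "\<phi> (f \<otimes>\<^bsub>Aut \<Gamma>\<lparr>carrier := G\<rparr>\<^esub> g) = \<phi> f \<otimes>\<^bsub>BijGroup E\<^esub> \<phi> g"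
      by (simp add: Aut_mult M B BijGroup_def)
  qed
qed

lemma group_action_vertices:
  assumes "subgroup G (Aut \<Gamma>)"
  shows "group_action (Aut \<Gamma>\<lparr>carrier := G\<rparr>) (pverts \<Gamma>) (\<lambda>g. g)"
  by (rule group_action_AutI[OF assms]) (auto simp: graph_auts_def)

lemma group_action_arcs:
  assumes "pair_graph \<Gamma>" "subgroup G (Aut \<Gamma>)"
  shows "group_action (Aut \<Gamma>\<lparr>carrier := G\<rparr>) (parcs \<Gamma>) (arc_action \<Gamma>)"
proof -
  interpret pair_graph \<Gamma> by fact
  note V = in_arcsD1 in_arcsD2
  show ?thesis
  proof (rule group_action_AutI[OF assms(2)])
    fix g assume "g \<in> graph_auts \<Gamma>"
    note g = graph_autsD[OF this]
    have inj: "inj_on (arc_action \<Gamma> g) (parcs \<Gamma>)"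
      using inj_onD[OF bij_betw_imp_inj_on[OF g(1)]]
      by (intro inj_onI) (auto simp: arc_action_def V)
    have "arc_action \<Gamma> g ` parcs \<Gamma> \<subseteq> parcs \<Gamma>"
      using g(3) by (auto simp: arc_action_def V)
    then have "arc_action \<Gamma> g ` parcs \<Gamma> = parcs \<Gamma>"
      using inj by (intro endo_inj_surj[OF pair_finite_arcs])
    then show "arc_action \<Gamma> g \<in> Bij (parcs \<Gamma>)"
      using inj by (simp add: Bij_def bij_betw_def) (simp add: arc_action_def)
  next
    fix f g assume "f \<in> graph_auts \<Gamma>" "g \<in> graph_auts \<Gamma>"
    note F = graph_autsD[OF this(1)] and G = graph_autsD[OF this(2)]
    show "arc_action \<Gamma> (compose (pverts \<Gamma>) f g) = compose (parcs \<Gamma>) (arc_action \<Gamma> f) (arc_action \<Gamma> g)"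
      using G(3) V by (auto simp: arc_action_def compose_def restrict_def fun_eq_iff)
  qed
qed

lemma group_action_edges:
  assumes "pair_graph \<Gamma>" "subgroup G (Aut \<Gamma>)"
  shows "group_action (Aut \<Gamma>\<lparr>carrier := G\<rparr>) (uedges \<Gamma>) (edge_action \<Gamma>)"
proof -
  interpret pair_graph \<Gamma> by fact
  have V: "e \<subseteq> pverts \<Gamma>" if "e \<in> uedges \<Gamma>" for e
    using that by (auto simp: uedges_def dest: in_arcsD1 in_arcsD2)
  have E: "g ` e \<in> uedges \<Gamma>" if gA: "g \<in> graph_auts \<Gamma>" and eE: "e \<in> uedges \<Gamma>" for g e
  proof -
    obtain u v where uv: "e = {u, v}" "(u, v) \<in> parcs \<Gamma>"
      using eE by (auto simp: uedges_def)
    then have "(g u, g v) \<in> parcs \<Gamma>"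
      using graph_autsD(3)[OF gA] in_arcsD1 in_arcsD2 by metis
    then show ?thesis using uv by (force simp: uedges_def)
  qed
  have fin: "finite (uedges \<Gamma>)"
    unfolding uedges_def by (rule finite_imageI[OF pair_finite_arcs])
  show ?thesis
  proof (rule group_action_AutI[OF assms(2)])
    fix g assume gA: "g \<in> graph_auts \<Gamma>"
    note g = graph_autsD[OF gA]
    have inj: "inj_on (edge_action \<Gamma> g) (uedges \<Gamma>)"
      using inj_on_image_eq_iff[OF bij_betw_imp_inj_on[OF g(1)] V V]
      by (intro inj_onI) (simp add: edge_action_def)
    have "edge_action \<Gamma> g ` uedges \<Gamma> \<subseteq> uedges \<Gamma>"
      using E[OF gA] by (auto simp: edge_action_def)
    then have "edge_action \<Gamma> g ` uedges \<Gamma> = uedges \<Gamma>"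
      using inj by (intro endo_inj_surj[OF fin])
    then show "edge_action \<Gamma> g \<in> Bij (uedges \<Gamma>)"
      using inj by (simp add: Bij_def bij_betw_def) (simp add: edge_action_def)
  next
    fix f g assume fg: "f \<in> graph_auts \<Gamma>" "g \<in> graph_auts \<Gamma>"
    have "compose (pverts \<Gamma>) f g ` e = f ` g ` e" if "e \<in> uedges \<Gamma>" for e
      unfolding image_image using V[OF that] by (intro image_cong) (auto simp: compose_def)
    then show "edge_action \<Gamma> (compose (pverts \<Gamma>) f g)
        = compose (uedges \<Gamma>) (edge_action \<Gamma> f) (edge_action \<Gamma> g)"
      using E[OF fg(2)] by (auto simp: edge_action_def compose_def restrict_def fun_eq_iff)
  qed
qed

lemma half_arc_transitive_iff:
  assumes "pair_graph \<Gamma>"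
  shows "half_arc_transitive \<Gamma> G \<longleftrightarrow> subgroup G (Aut \<Gamma>) \<and>
     (\<forall>u\<in>pverts \<Gamma>. \<forall>v\<in>pverts \<Gamma>. \<exists>g\<in>G. g u = v) \<and>
     (\<forall>e\<in>uedges \<Gamma>. \<forall>e'\<in>uedges \<Gamma>. \<exists>g\<in>G. g ` e = e') \<and>
     \<not> (\<forall>(u, v)\<in>parcs \<Gamma>. \<forall>(u', v')\<in>parcs \<Gamma>. \<exists>g\<in>G. g u = u' \<and> g v = v')"
  using group_action_vertices[of G \<Gamma>] group_action_edges[OF assms, of G]
    group_action_arcs[OF assms, of G]
  unfolding half_arc_transitive_def transitive_action_def transitive_action_axioms_def
  by (auto simp: edge_action_def arc_action_def Ball_def)

end

theory Submission
  imports Defs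
begin

text \<open>
  Let \<open>D\<close> be an orientation induced by \<open>G\<close>. Since \<open>G\<close> is transitive on \<open>D\<close>, every \<open>G\<close>-equivariant map
  \<open>D \<rightarrow> D\<close> is a permutation, and two such maps that agree at one arc are equal. Examples are the map
  \<open>s\<close> to the other arc with the same tail and the map \<open>t\<close> to the other arc with the same head.

  Up to rotation and reflection an undirected pentagon contains \<open>a \<rightarrow> b \<rightarrow> c \<rightarrow> d \<rightarrow> e \<leftarrow> a\<close>, or
  \<open>u \<rightarrow> a \<rightarrow> b \<rightarrow> v \<leftarrow> c \<leftarrow> u\<close>, or \<open>v\<^sub>0 \<rightarrow> v\<^sub>1 \<rightarrow> v\<^sub>2 \<leftarrow> v\<^sub>3 \<rightarrow> v\<^sub>4 \<leftarrow> v\<^sub>0\<close>. As the girth is \<open>5\<close>, each pattern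
  singles out for every arc one of its two continuations, that is, an equivariant \<open>m\<close> such that the tail
  of \<open>m e\<close> is the head of \<open>e\<close>. Then \<open>t = m\<inverse> s m\<close>, and the pentagon becomes a relation between the
  involution \<open>s\<close> and \<open>m\<close>; nine relations are possible. Five of them produce cycles of length at most \<open>4\<close>.
  The others define groups of order \<open>54\<close> (twice) and \<open>48\<close> (twice), whose multiplication tables
  describe \<open>X_o 3 9 4\<close> and \<open>rose_window 12 5 2\<close>. A proper quotient cannot occur, because it would have at most
  \<open>13\<close> vertices, whereas girth \<open>5\<close> and valency \<open>4\<close> require more.
\<close>

section \<open>Orientations with an arc-transitive group\<close>

lemma in_symcl_iff: "(u, v) \<in> R\<^sup>s \<longleftrightarrow> (u, v) \<in> R \<or> (v, u) \<in> R"
  by (auto simp: symcl_def)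

lemma card_2_ex1_other:
  assumes "card A = 2" "x \<in> A"
  shows "\<exists>!y. y \<in> A \<and> y \<noteq> x"
proof -
  obtain a b where "A = {a, b}" "a \<noteq> b"
    using assms(1) by (auto simp: card_2_iff)
  then show ?thesis using assms(2) by auto
qed

text \<open>The locale keeps what the arguments use of a half-arc-transitive action on a tetravalent
  graph of girth 5. \<open>V_connected\<close> is connectedness in the form in which it is applied,
  namely to sets of tails closed along arcs in both directions, so that no walks are needed.\<close>

locale arc_transitive_orientation =
  fixes V :: "'a set" and D :: "('a \<times> 'a) set" and G :: "('a \<Rightarrow> 'a) set"
  assumes finite_V: "finite V"
    and D_sub: "D \<subseteq> V \<times> V"
    and D_nonempty: "D \<noteq> {}"
    and G_inj: "g \<in> G \<Longrightarrow> inj_on g V"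
    and G_arc: "g \<in> G \<Longrightarrow> (u, v) \<in> D \<Longrightarrow> (g u, g v) \<in> D"
    and G_transitive: "(u, v) \<in> D \<Longrightarrow> (u', v') \<in> D \<Longrightarrow> \<exists>g\<in>G. g u = u' \<and> g v = v'"
    and card_out: "v \<in> V \<Longrightarrow> card (D `` {v}) = 2"
    and card_in: "v \<in> V \<Longrightarrow> card (D\<inverse> `` {v}) = 2"
    and asym: "(u, v) \<in> D \<Longrightarrow> (v, u) \<notin> D"
    and no_triangle: "(a, b) \<in> D\<^sup>s \<Longrightarrow> (b, c) \<in> D\<^sup>s \<Longrightarrow> (c, a) \<notin> D\<^sup>s"
    and no_square: "(a, b) \<in> D\<^sup>s \<Longrightarrow> (b, c) \<in> D\<^sup>s \<Longrightarrow> (c, d) \<in> D\<^sup>s \<Longrightarrow> (d, a) \<in> D\<^sup>s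
      \<Longrightarrow> a = c \<or> b = d"
    and V_connected: "U \<subseteq> V \<Longrightarrow> U \<noteq> {} \<Longrightarrow> (\<And>u v. (u, v) \<in> D \<Longrightarrow> u \<in> U \<longleftrightarrow> v \<in> U) \<Longrightarrow> U = V"
begin

lemma finite_D: "finite D"
  using finite_subset[OF D_sub] finite_V by blast

text \<open>\<open>sib\<close> and \<open>cosib\<close> are the maps \<open>s\<close> and
  \<open>t\<close> of the overview. Taking the identity outside \<open>D\<close> makes
  \<open>sib_sib\<close> an equation without side condition, as the word problems below
  require.\<close>

definition sib :: "'a \<times> 'a \<Rightarrow> 'a \<times> 'a" where
  "sib e = (if e \<in> D then (fst e, THE w. (fst e, w) \<in> D \<and> w \<noteq> snd e) else e)"

definition cosib :: "'a \<times> 'a \<Rightarrow> 'a \<times> 'a" where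
  "cosib e = (if e \<in> D then (THE w. (w, snd e) \<in> D \<and> w \<noteq> fst e, snd e) else e)"

lemma ex1_sib: "(u, v) \<in> D \<Longrightarrow> \<exists>!w. (u, w) \<in> D \<and> w \<noteq> v"
  using card_2_ex1_other[OF card_out, of u v] D_sub by auto

lemma ex1_cosib: "(u, v) \<in> D \<Longrightarrow> \<exists>!w. (w, v) \<in> D \<and> w \<noteq> u"
  using card_2_ex1_other[OF card_in, of v u] D_sub by auto

lemma sib_eq: "(u, v) \<in> D \<Longrightarrow> (u, w) \<in> D \<Longrightarrow> w \<noteq> v \<Longrightarrow> sib (u, v) = (u, w)"
  using the1_equality[OF ex1_sib] by (simp add: sib_def)

lemma cosib_eq: "(u, v) \<in> D \<Longrightarrow> (w, v) \<in> D \<Longrightarrow> w \<noteq> u \<Longrightarrow> cosib (u, v) = (w, v)"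
  using the1_equality[OF ex1_cosib] by (simp add: cosib_def)

lemma sibE:
  assumes "e \<in> D"
  obtains w where "sib e = (fst e, w)" "(fst e, w) \<in> D" "w \<noteq> snd e" "sib (fst e, w) = e"
proof -
  obtain w where "(fst e, w) \<in> D" "w \<noteq> snd e"
    using ex1_sib[of "fst e" "snd e"] assms by auto
  moreover from this have "sib e = (fst e, w)" "sib (fst e, w) = e"
    using sib_eq[of "fst e" "snd e" w] sib_eq[of "fst e" w "snd e"] assms by auto
  ultimately show ?thesis using that by blast
qed

lemma cosibE:
  assumes "e \<in> D"
  obtains w where "cosib e = (w, snd e)" "(w, snd e) \<in> D" "w \<noteq> fst e" "cosib (w, snd e) = e"
proof -
  obtain w where "(w, snd e) \<in> D" "w \<noteq> fst e"
    using ex1_cosib[of "fst e" "snd e"] assms by auto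
  moreover from this have "cosib e = (w, snd e)" "cosib (w, snd e) = e"
    using cosib_eq[of "fst e" "snd e" w] cosib_eq[of w "snd e" "fst e"] assms by auto
  ultimately show ?thesis using that by blast
qed

lemma sib_simps:
  assumes "e \<in> D"
  shows "sib e \<in> D" "fst (sib e) = fst e" "snd (sib e) \<noteq> snd e" "sib e \<noteq> e"
  by (metis sibE[OF assms] fst_conv snd_conv)+

lemma cosib_simps:
  assumes "e \<in> D"
  shows "cosib e \<in> D" "snd (cosib e) = snd e" "fst (cosib e) \<noteq> fst e" "cosib e \<noteq> e"
  by (metis cosibE[OF assms] fst_conv snd_conv)+

lemma sib_sib: "sib (sib e) = e"
proof (cases "e \<in> D")
  case True then show ?thesis by (rule sibE) simp
qed (simp add: sib_def)

lemma same_tail: "e \<in> D \<Longrightarrow> f \<in> D \<Longrightarrow> fst f = fst e \<Longrightarrow> f = e \<or> f = sib e"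
  by (metis prod.collapse sib_eq)

definition equivariant :: "('a \<times> 'a \<Rightarrow> 'a \<times> 'a) \<Rightarrow> bool" where
  "equivariant f \<longleftrightarrow>
     (\<forall>e\<in>D. f e \<in> D \<and> (\<forall>g\<in>G. f (map_prod g g e) = map_prod g g (f e)))"

lemma equivariantD:
  assumes "equivariant f" "e \<in> D"
  shows "f e \<in> D" "g \<in> G \<Longrightarrow> f (map_prod g g e) = map_prod g g (f e)"
  using assms by (auto simp: equivariant_def)

lemma G_arc': "g \<in> G \<Longrightarrow> e \<in> D \<Longrightarrow> map_prod g g e \<in> D"
  using G_arc by (cases e) auto

lemma G_transitive':
  assumes "e \<in> D" "f \<in> D" obtains g where "g \<in> G" "map_prod g g e = f"
  using G_transitive[of "fst e" "snd e" "fst f" "snd f"] assms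
  by (metis map_prod_simp prod.collapse)

lemma equivariant_comp: "equivariant f \<Longrightarrow> equivariant f' \<Longrightarrow> equivariant (\<lambda>e. f (f' e))"
  by (auto simp: equivariant_def)

lemma equivariant_sib: "equivariant sib"
  unfolding equivariant_def
proof (intro ballI conjI)
  fix e g assume e: "e \<in> D" and g: "g \<in> G"
  obtain w where w: "sib e = (fst e, w)" "(fst e, w) \<in> D" "w \<noteq> snd e"
    using e by (rule sibE)
  have "g w \<noteq> g (snd e)"
    using w(2,3) e D_sub inj_onD[OF G_inj[OF g]] by (cases e) auto
  then have "sib (g (fst e), g (snd e)) = (g (fst e), g w)"
    using w e G_arc[OF g] by (intro sib_eq) auto
  then show "sib (map_prod g g e) = map_prod g g (sib e)"
    using w by (cases e) simp
qed (rule sib_simps)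

lemma equivariant_cosib: "equivariant cosib"
  unfolding equivariant_def
proof (intro ballI conjI)
  fix e g assume e: "e \<in> D" and g: "g \<in> G"
  obtain w where w: "cosib e = (w, snd e)" "(w, snd e) \<in> D" "w \<noteq> fst e"
    using e by (rule cosibE)
  have "g w \<noteq> g (fst e)"
    using w(2,3) e D_sub inj_onD[OF G_inj[OF g]] by (cases e) auto
  then have "cosib (g (fst e), g (snd e)) = (g w, g (snd e))"
    using w e G_arc[OF g] by (intro cosib_eq) auto
  then show "cosib (map_prod g g e) = map_prod g g (cosib e)"
    using w by (cases e) simp
qed (rule cosib_simps)

lemma equivariant_agree:
  assumes "equivariant f" "equivariant f'" "e\<^sub>0 \<in> D" "f e\<^sub>0 = f' e\<^sub>0" "e \<in> D"
  shows "f e = f' e"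
proof -
  obtain g where "g \<in> G" "map_prod g g e\<^sub>0 = e"
    using assms(3,5) by (rule G_transitive')
  then show ?thesis
    using equivariantD(2)[OF assms(1,3)] equivariantD(2)[OF assms(2,3)] assms(4) by metis
qed

text \<open>
  Replaces any computation of vertex stabilisers: being defined on all arcs in a uniform way is
  already enough for a map to be invertible.
\<close>

lemma equivariant_bij:
  assumes f: "equivariant f"
  shows "bij_betw f D D"
proof -
  \<comment> \<open>Transitivity gives surjectivity, since \<open>e\<close> is a translate of the
    value \<open>f e\<^sub>0\<close>; finiteness of \<open>D\<close> then gives injectivity.\<close>
  have "D \<subseteq> f ` D"
  proof
    fix e assume "e \<in> D"
    obtain e\<^sub>0 where e\<^sub>0: "e\<^sub>0 \<in> D" using D_nonempty by auto
    obtain g where g: "g \<in> G" "map_prod g g (f e\<^sub>0) = e"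
      using equivariantD(1)[OF f e\<^sub>0] \<open>e \<in> D\<close> by (rule G_transitive')
    then have "f (map_prod g g e\<^sub>0) = e"
      using equivariantD(2)[OF f e\<^sub>0] by simp
    then show "e \<in> f ` D" using G_arc'[OF g(1) e\<^sub>0] by blast
  qed
  moreover have "f ` D \<subseteq> D" using equivariantD(1)[OF f] by auto
  ultimately show ?thesis
    using finite_surj_inj[OF finite_D, of f] by (auto simp: bij_betw_def)
qed

lemma equivariant_inv:
  assumes f: "equivariant f"
  shows "equivariant (the_inv_into D f)"
proof -
  have bij: "inj_on f D" "f ` D = D"
    using equivariant_bij[OF f] by (auto simp: bij_betw_def)
  show ?thesis
    unfolding equivariant_def
  proof (intro ballI conjI)
    fix e assume e: "e \<in> D"
    then show *: "the_inv_into D f e \<in> D"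
      using the_inv_into_into[OF bij(1), of e D] bij(2) by auto
    fix g assume g: "g \<in> G"
    have "f (map_prod g g (the_inv_into D f e)) = map_prod g g e"
      using equivariantD(2)[OF f * g] f_the_inv_into_f[OF bij(1)] e bij(2) by simp
    then show "the_inv_into D f (map_prod g g e) = map_prod g g (the_inv_into D f e)"
      using the_inv_into_f_eq[OF bij(1)] G_arc'[OF g *] by blast
  qed
qed

text \<open>A pentagon provides one pair in the invariant relation \<open>Q\<close>. Its translates
  give every arc a partner, and uniqueness makes the choice of the partner commute with
  \<open>G\<close>.\<close>

lemma equivariant_choice:
  assumes inv: "\<And>g e f. g \<in> G \<Longrightarrow> e \<in> D \<Longrightarrow> f \<in> D \<Longrightarrow> Q e f \<Longrightarrow> Q (map_prod g g e) (map_prod g g f)"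
    and uniq: "\<And>e f f'. e \<in> D \<Longrightarrow> f \<in> D \<Longrightarrow> f' \<in> D \<Longrightarrow> Q e f \<Longrightarrow> Q e f' \<Longrightarrow> f = f'"
    and ex: "e\<^sub>0 \<in> D" "f\<^sub>0 \<in> D" "Q e\<^sub>0 f\<^sub>0"
  obtains \<phi> where "equivariant \<phi>" "\<And>e. e \<in> D \<Longrightarrow> Q e (\<phi> e)"
proof -
  define \<phi> where "\<phi> e = (THE f. f \<in> D \<and> Q e f)" for e
  have eq: "\<phi> e = f" if "e \<in> D" "f \<in> D" "Q e f" for e f
    unfolding \<phi>_def
    by (rule the_equality) (use that(2,3) uniq[OF that(1) _ that(2) _ that(3)] in blast)+
  have *: "\<phi> e \<in> D \<and> Q e (\<phi> e)" if e: "e \<in> D" for e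
  proof -
    obtain g where g: "g \<in> G" "map_prod g g e\<^sub>0 = e"
      using ex(1) e by (rule G_transitive')
    have "map_prod g g f\<^sub>0 \<in> D" "Q e (map_prod g g f\<^sub>0)"
      using inv[OF g(1) ex] G_arc'[OF g(1) ex(2)] g(2) by auto
    then show ?thesis using eq[OF e] G_arc'[OF g(1) ex(2)] by metis
  qed
  have "equivariant \<phi>"
    unfolding equivariant_def
  proof (intro ballI conjI)
    fix e g assume "e \<in> D" "g \<in> G"
    then show "\<phi> (map_prod g g e) = map_prod g g (\<phi> e)"
      using *[of e] inv[of g e "\<phi> e"] G_arc' by (intro eq) auto
  qed (use * in blast)
  then show ?thesis using * that by blast
qed

end

section \<open>Coding an orientation by a permutation of its arcs\<close>

text \<open>With one arc of \<open>R\<close> for each tail and \<open>sib\<close> for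
  \<open>s\<close>, the positions \<open>2 * i\<close> and \<open>2 * i + 1\<close> hold the two
  arcs leaving the \<open>i\<close>-th vertex, so halving a position gives the number of the
  tail.\<close>

definition arc_list :: "('b \<Rightarrow> 'b) \<Rightarrow> 'b list \<Rightarrow> 'b list" where
  "arc_list s R = concat (map (\<lambda>e. [e, s e]) R)"

lemma length_arc_list [simp]: "length (arc_list s R) = 2 * length R"
  by (induction R) (simp_all add: arc_list_def)

lemma nth_arc_list:
  "k < 2 * length R \<Longrightarrow> arc_list s R ! k = (if even k then R ! (k div 2) else s (R ! (k div 2)))"
proof (induction R arbitrary: k)
  case (Cons e R)
  then show ?case
    by (cases k; cases "k - 1") (auto simp: arc_list_def)
qed simp

lemma set_arc_list: "set (arc_list s R) = set R \<union> s ` set R"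
  by (induction R) (auto simp: arc_list_def)

text \<open>
  A code \<open>c\<close> of length \<open>2 n\<close> describes an orientation on the vertices \<open>0, \<dots>, n - 1\<close>: the arcs leaving \<open>i\<close>
  have the indices \<open>2 i\<close> and \<open>2 i + 1\<close>, and the \<open>k\<close>-th arc is followed by the arc with index \<open>c ! k\<close>.
\<close>

definition code_arcs :: "nat list \<Rightarrow> (nat \<times> nat) set" where
  "code_arcs c = (\<lambda>k. (k div 2, c ! k div 2)) ` {..<length c}"

text \<open>The symmetric closure forgets directions, so a table obtained from the reversed
  orientation still describes the same graph.\<close>

definition coded_by :: "nat list \<Rightarrow> 'a set \<Rightarrow> ('a \<times> 'a) set \<Rightarrow> bool" where
  "coded_by c V E \<longleftrightarrow>
     (\<exists>h. bij_betw h {..<length c div 2} V \<and> E = map_prod h h ` (code_arcs c)\<^sup>s)"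

lemma map_prod_symcl: "map_prod h h ` R\<^sup>s = (map_prod h h ` R)\<^sup>s"
  by (auto simp: symcl_def image_iff)

lemma symcl_converse: "(R\<inverse>)\<^sup>s = R\<^sup>s"
  by (auto simp: symcl_def image_iff)

context arc_transitive_orientation
begin

text \<open>\<open>B\<close> contains both arcs at each of its tails. The set of tails is closed
  forwards along arcs because \<open>m\<close> maps \<open>B\<close> into itself, and backwards
  because by finiteness \<open>m\<close> permutes \<open>B\<close>. Connectedness does the
  rest.\<close>

lemma closed_under_successor:
  assumes m: "bij_betw m D D" "\<And>e. e \<in> D \<Longrightarrow> fst (m e) = snd e"
    and B: "B \<subseteq> D" "B \<noteq> {}" "sib ` B \<subseteq> B" "m ` B \<subseteq> B"
  shows "B = D"
proof -
  have tails: "e \<in> B" if "e \<in> D" "fst e \<in> fst ` B" for e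
  proof -
    obtain b where "b \<in> B" "fst e = fst b" using \<open>fst e \<in> fst ` B\<close> by auto
    then have "e = b \<or> e = sib b"
      using same_tail[of b e] that B(1) by auto
    then show ?thesis using \<open>b \<in> B\<close> B(3) by auto
  qed
  have inj: "inj_on m D" using m(1) by (simp add: bij_betw_def)
  have mB: "m ` B = B"
    using endo_inj_surj[OF finite_subset[OF B(1) finite_D] B(4) inj_on_subset[OF inj B(1)]] .
  have "fst ` B = V"
  proof (rule V_connected)
    show "fst ` B \<subseteq> V" using B(1) D_sub by auto
    show "fst ` B \<noteq> {}" using B(2) by simp
    fix u v assume uv: "(u, v) \<in> D"
    then have fm: "fst (m (u, v)) = v" "m (u, v) \<in> D"
      using m(2)[of "(u, v)"] bij_betwE[OF m(1)] by auto
    show "u \<in> fst ` B \<longleftrightarrow> v \<in> fst ` B"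
    proof
      assume "u \<in> fst ` B"
      then have "m (u, v) \<in> B" using tails[OF uv] B(4) by auto
      then show "v \<in> fst ` B" using fm(1) by force
    next
      assume "v \<in> fst ` B"
      then have "m (u, v) \<in> m ` B" using tails[OF fm(2)] fm(1) mB by simp
      then have "(u, v) \<in> B"
        using inj_on_image_mem_iff[OF inj uv B(1)] by simp
      then show "u \<in> fst ` B" by force
    qed
  qed
  then have "fst e \<in> fst ` B" if "e \<in> D" for e
    using subsetD[OF D_sub that] by (cases e) simp
  then show ?thesis using tails B(1) by blast
qed

lemma card_neighbours: "u \<in> V \<Longrightarrow> card (D\<^sup>s `` {u}) = 4"
proof -
  assume "u \<in> V"
  have "D\<^sup>s `` {u} = D `` {u} \<union> D\<inverse> `` {u}" by (auto simp: in_symcl_iff)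
  moreover have "D `` {u} \<inter> D\<inverse> `` {u} = {}" using asym by auto
  moreover have "finite (D `` {u})" "finite (D\<inverse> `` {u})"
    using finite_D by (auto intro: finite_Image)
  ultimately show ?thesis
    using card_Un_disjoint[of "D `` {u}" "D\<inverse> `` {u}"] card_out card_in \<open>u \<in> V\<close> by simp
qed

lemma card_D: "card D = 2 * card V"
proof -
  have "D = Sigma V (\<lambda>v. D `` {v})" using D_sub by auto
  then have "card D = (\<Sum>v\<in>V. card (D `` {v}))"
    using card_SigmaI[of V "\<lambda>v. D `` {v}"] finite_V finite_D by (simp add: finite_Image)
  then show ?thesis using card_out by simp
qed

text \<open>This is the count behind the Moore bound: four neighbours, and three further neighbours
  of each. Without squares the four triples are disjoint, and without triangles they avoid the
  neighbours. The central vertex is left out of the count.\<close>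

lemma card_V_ge: "16 \<le> card V"
proof -
  obtain v where v: "v \<in> V" using D_nonempty D_sub by auto
  define N where "N = D\<^sup>s `` {v}"
  define S where "S = (\<Union>u\<in>N. D\<^sup>s `` {u} - {v})"
  have sub: "D\<^sup>s `` X \<subseteq> V" for X using D_sub by (auto simp: in_symcl_iff)
  have fin: "finite (D\<^sup>s `` X)" for X using finite_subset[OF sub finite_V] .
  have NV: "u \<in> V" "v \<in> D\<^sup>s `` {u}" if "u \<in> N" for u
    using that sub[of "{v}"] unfolding N_def by (auto simp: in_symcl_iff)
  have "card S = (\<Sum>u\<in>N. card (D\<^sup>s `` {u} - {v}))"
    unfolding S_def
  proof (rule card_UN_disjoint)
    show "finite N" unfolding N_def by (rule fin)
    show "\<forall>u\<in>N. finite (D\<^sup>s `` {u} - {v})" using fin by auto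
    show "\<forall>u\<in>N. \<forall>w\<in>N. u \<noteq> w \<longrightarrow> (D\<^sup>s `` {u} - {v}) \<inter> (D\<^sup>s `` {w} - {v}) = {}"
    proof (intro ballI impI equals0I)
      fix u w x
      assume "u \<in> N" "w \<in> N" "u \<noteq> w" "x \<in> (D\<^sup>s `` {u} - {v}) \<inter> (D\<^sup>s `` {w} - {v})"
      then show False
        using no_square[of v u x w] by (auto simp: N_def in_symcl_iff)
    qed
  qed
  also have "\<dots> = (\<Sum>u\<in>N. 3)"
    using NV card_neighbours fin by (intro sum.cong) auto
  also have "\<dots> = 12" using card_neighbours[OF v] by (simp add: N_def)
  finally have "card S = 12" .
  moreover have "N \<inter> S = {}"
  proof (rule equals0I)
    fix x assume "x \<in> N \<inter> S"
    then obtain u where "(v, x) \<in> D\<^sup>s" "(v, u) \<in> D\<^sup>s" "(u, x) \<in> D\<^sup>s" by (auto simp: N_def S_def)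
    then show False using no_triangle[of v u x] by (auto simp: in_symcl_iff)
  qed
  moreover have "finite S" unfolding S_def N_def using fin by auto
  moreover have "finite N" "card N = 4" using fin card_neighbours[OF v] by (auto simp: N_def)
  ultimately have "card (N \<union> S) = 16" by (simp add: card_Un_disjoint)
  moreover have "N \<union> S \<subseteq> V" unfolding N_def S_def using sub by auto
  ultimately show ?thesis using card_mono[OF finite_V] by metis
qed

text \<open>
  The list \<open>arc_list sib R\<close> consists of images of one arc under words in \<^const>\<open>sib\<close> and \<open>n\<close>; by
  assumption it is closed under both maps. The number of occurrences of an arc does not decrease
  along either map, so a repetition would make the list at least twice as long as \<open>D\<close> is large.
\<close>

lemma coded_by_table:
  assumes n: "bij_betw n D D"
    and succ: "(\<forall>e\<in>D. fst (n e) = snd e) \<or> (\<forall>e\<in>D. snd (n e) = fst e)"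
    and R: "R \<noteq> []" "set R \<subseteq> D" "length R < 32"
    and c: "length c = 2 * length R" "distinct c" "\<forall>k\<in>set c. k < 2 * length R"
    and table: "map n (arc_list sib R) = map ((!) (arc_list sib R)) c"
  shows "coded_by c V (D\<^sup>s)"
proof -
  define L where "L = arc_list sib R"
  define N where "N = 2 * length R"
  have lenL: "length L = N" by (simp add: L_def N_def)
  have LD: "set L \<subseteq> D" using R(2) sib_simps(1) by (auto simp: L_def set_arc_list)
  have inj: "inj_on n D" using n by (simp add: bij_betw_def)
  have nL: "n (L ! k) = L ! (c ! k)" and cN: "c ! k < N" if "k < N" for k
  proof -
    have "n (L ! k) = map n L ! k" using that lenL by simp
    also have "\<dots> = L ! (c ! k)" using table that c(1) unfolding L_def N_def by simp
    finally show "n (L ! k) = L ! (c ! k)" .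
    show "c ! k < N" using c(1,3) that unfolding N_def by simp
  qed
  \<comment> \<open>In the second case \<open>n\<close> goes backwards along arcs, and its inverse
    is a successor map.\<close>
  have closed: "B = D" if B: "B \<subseteq> D" "B \<noteq> {}" "sib ` B \<subseteq> B" "n ` B \<subseteq> B" for B
    using succ
  proof
    assume "\<forall>e\<in>D. fst (n e) = snd e"
    then show ?thesis by (intro closed_under_successor[OF n _ B]) simp
  next
    assume pred: "\<forall>e\<in>D. snd (n e) = fst e"
    define m where "m = the_inv_into D n"
    have m: "bij_betw m D D" unfolding m_def using n by (rule bij_betw_the_inv_into)
    have mn: "m (n e) = e" "n (m e) = e" if "e \<in> D" for e
      using that n unfolding m_def bij_betw_def
      by (simp_all add: the_inv_into_f_f f_the_inv_into_f)
    have "fst (m e) = snd e" if "e \<in> D" for e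
      using bspec[OF pred, of "m e"] mn(2)[OF that] bij_betwE[OF m] that by simp
    moreover have "m ` B \<subseteq> B"
    proof
      fix x assume "x \<in> m ` B"
      moreover have "n ` B = B"
        using endo_inj_surj[OF finite_subset[OF B(1) finite_D] B(4) inj_on_subset[OF inj B(1)]] .
      ultimately obtain b where "b \<in> B" "x = m (n b)" by (metis imageE)
      then show "x \<in> B" using mn(1)[of b] B(1) by auto
    qed
    ultimately show ?thesis by (intro closed_under_successor[OF m _ B(1-3)])
  qed
  have setL: "set L = D"
  proof (rule closed)
    show "set L \<subseteq> D" by (rule LD)
    show "set L \<noteq> {}" using R(1) by (simp add: L_def set_arc_list)
    show "sib ` set L \<subseteq> set L" by (auto simp: L_def set_arc_list sib_sib)
    show "n ` set L \<subseteq> set L"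
      using nL cN lenL by (force simp: in_set_conv_nth)
  qed
  have LkD: "L ! k \<in> D" if "k < N" for k using that setL lenL nth_mem by blast
  define occ where "occ d = {k. k < N \<and> L ! k = d}" for d
  have fin: "finite (occ d)" for d by (simp add: occ_def)
  have occ_n: "card (occ d) \<le> card (occ (n d))" for d
  proof (rule card_inj_on_le[OF _ _ fin])
    show "inj_on ((!) c) (occ d)"
      using c(1,2) by (auto simp: occ_def N_def inj_on_def nth_eq_iff_index_eq)
    show "(!) c ` occ d \<subseteq> occ (n d)" using nL cN by (auto simp: occ_def)
  qed
  \<comment> \<open>\<open>sw\<close> exchanges the positions of the two arcs with a common
    tail.\<close>
  define sw where "sw k = (if even k then k + 1 else k - 1)" for k :: nat
  have sw: "sw k < N" "L ! sw k = sib (L ! k)" if "k < N" for k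
  proof -
    show "sw k < N" using that by (auto simp: sw_def N_def elim!: evenE)
    then show "L ! sw k = sib (L ! k)"
      using that unfolding L_def N_def by (auto simp: nth_arc_list sw_def sib_sib elim!: oddE)
  qed
  have sw_sw: "sw (sw k) = k" for k by (auto simp: sw_def elim!: oddE)
  have occ_sib: "card (occ d) \<le> card (occ (sib d))" for d
  proof (rule card_inj_on_le[OF _ _ fin])
    show "inj_on sw (occ d)" by (metis inj_onI sw_sw)
    show "sw ` occ d \<subseteq> occ (sib d)" using sw by (auto simp: occ_def)
  qed
  have "distinct L"
  proof (rule ccontr)
    assume "\<not> distinct L"
    then obtain i j where ij: "i < N" "j < N" "i \<noteq> j" "L ! i = L ! j"
      using lenL by (auto simp: distinct_conv_nth)
    \<comment> \<open>The arcs that occur at least twice form a set closed under both maps, so a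
      single repetition forces every arc to be repeated.\<close>
    have "{d \<in> D. 2 \<le> card (occ d)} = D"
    proof (rule closed)
      have "card {i, j} \<le> card (occ (L ! i))"
        using ij by (intro card_mono fin) (auto simp: occ_def)
      then have "2 \<le> card (occ (L ! i))" using ij by simp
      then show "{d \<in> D. 2 \<le> card (occ d)} \<noteq> {}" using LkD[OF ij(1)] by blast
      show "sib ` {d \<in> D. 2 \<le> card (occ d)} \<subseteq> {d \<in> D. 2 \<le> card (occ d)}"
        using occ_sib sib_simps(1) order_trans by blast
      show "n ` {d \<in> D. 2 \<le> card (occ d)} \<subseteq> {d \<in> D. 2 \<le> card (occ d)}"
        using occ_n bij_betwE[OF n] order_trans by blast
    qed auto
    then have "(\<Sum>d\<in>D. 2) \<le> (\<Sum>d\<in>D. card (occ d))" by (intro sum_mono) blast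
    also have "\<dots> = card (\<Union>d\<in>D. occ d)"
      using finite_D fin by (intro card_UN_disjoint[symmetric]) (auto simp: occ_def)
    also have "\<dots> \<le> card {..<N}" by (intro card_mono) (auto simp: occ_def)
    \<comment> \<open>With at least 16 vertices there are at least 32 arcs, which explains the bound
      on \<open>length R\<close>.\<close>
    finally have "card D \<le> length R" by (simp add: N_def)
    then show False using card_V_ge card_D R(3) by simp
  qed
  define h where "h i = fst (R ! i)" for i
  have tail: "fst (L ! k) = h (k div 2)" if "k < N" for k
  proof -
    have "R ! (k div 2) \<in> D" using that subsetD[OF R(2) nth_mem] by (auto simp: N_def)
    then show ?thesis
      using that unfolding L_def N_def by (simp add: nth_arc_list sib_simps h_def)
  qed
  have evenL: "L ! (2 * i) = R ! i" "L ! (2 * i + 1) = sib (R ! i)" if "i < length R" for i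
    using that by (auto simp: L_def nth_arc_list)
  have "inj_on h {..<length R}"
  proof (rule inj_onI, simp only: lessThan_iff)
    fix i j assume i: "i < length R" and j: "j < length R" and "h i = h j"
    then have "R ! j = R ! i \<or> R ! j = sib (R ! i)"
      using same_tail[of "R ! i" "R ! j"] subsetD[OF R(2) nth_mem] by (auto simp: h_def)
    then have "L ! (2 * j) = L ! (2 * i) \<or> L ! (2 * j) = L ! (2 * i + 1)"
      using evenL i j by simp
    then have "2 * j = 2 * i \<or> 2 * j = 2 * i + 1"
      using nth_eq_iff_index_eq[OF \<open>distinct L\<close>] lenL i j by (simp add: N_def)
    then show "i = j" by presburger
  qed
  moreover have "h ` {..<length R} = V"
  proof
    show "h ` {..<length R} \<subseteq> V"
      using subsetD[OF D_sub subsetD[OF R(2) nth_mem]] by (auto simp: h_def mem_Times_iff)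
    show "V \<subseteq> h ` {..<length R}"
    proof
      fix v assume "v \<in> V"
      then have "D `` {v} \<noteq> {}" using card_out[of v] by force
      then obtain w where "(v, w) \<in> set L" using setL by auto
      then obtain k where k: "k < N" "L ! k = (v, w)" using lenL by (auto simp: in_set_conv_nth)
      then have "v = h (k div 2)" "k div 2 < length R" using tail[of k] by (auto simp: N_def)
      then show "v \<in> h ` {..<length R}" by blast
    qed
  qed
  ultimately have bij: "bij_betw h {..<length c div 2} V" using c(1) by (simp add: bij_betw_def)
  have D_eq: "D = (!) L ` {..<N}"
    using setL lenL by (auto simp: set_conv_nth)
  have "D\<^sup>s = (map_prod h h ` code_arcs c)\<^sup>s"
    using succ
  proof
    assume *: "\<forall>e\<in>D. fst (n e) = snd e"
    have "L ! k = map_prod h h (k div 2, c ! k div 2)" if "k < N" for k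
    proof -
      have "snd (L ! k) = fst (n (L ! k))" using * LkD[OF that] by simp
      also have "\<dots> = h (c ! k div 2)" using tail[OF cN[OF that]] nL[OF that] by simp
      finally show ?thesis using tail[OF that] by (metis map_prod_simp prod.collapse)
    qed
    then have "D = map_prod h h ` code_arcs c"
      unfolding D_eq code_arcs_def image_image using c(1) by (intro image_cong) (auto simp: N_def)
    then show ?thesis by simp
  next
    assume *: "\<forall>e\<in>D. snd (n e) = fst e"
    have "n (L ! k) = map_prod h h (c ! k div 2, k div 2)" if "k < N" for k
    proof -
      have "snd (n (L ! k)) = h (k div 2)" using * LkD[OF that] tail[OF that] by simp
      moreover have "fst (n (L ! k)) = h (c ! k div 2)" using tail[OF cN[OF that]] nL[OF that] by simp
      ultimately show ?thesis by (metis map_prod_simp prod.collapse)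
    qed
    then have "n ` D = (\<lambda>k. map_prod h h (c ! k div 2, k div 2)) ` {..<length c}"
      unfolding D_eq image_image using c(1) by (intro image_cong) (auto simp: N_def)
    also have "\<dots> = (map_prod h h ` code_arcs c)\<inverse>"
      by (force simp: code_arcs_def)
    \<comment> \<open>Here the code describes the reverse of \<open>D\<close>, which has the same
      symmetric closure.\<close>
    finally have "D = (map_prod h h ` code_arcs c)\<inverse>"
      using n by (simp add: bij_betw_def)
    then show ?thesis using symcl_converse by metis
  qed
  then show ?thesis unfolding coded_by_def map_prod_symcl using bij by blast
qed

end

section \<open>Word problems\<close>

text \<open>The permutation of 54 arcs that \<open>m\<close> induces in \<open>table_holt\<close>.
  The words in \<open>R\<close> there are ordered such that vertex \<open>9 * i + j\<close> becomes
  the vertex \<open>(i, j)\<close> of \<open>X_o 3 9 4\<close>.\<close>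

definition holt_code :: "nat list" where
  "holt_code =
    [40, 50, 43, 53, 44, 37, 38, 47, 41, 48, 42, 51, 45, 52, 46, 36, 39, 49, 2, 17, 1, 4, 3,
    7, 9, 5, 11, 6, 8, 13, 10, 15, 16, 12, 0, 14, 27, 29, 31, 28, 30, 32, 34, 33, 35, 18,
    21, 19, 20, 23, 24, 22, 25, 26]"

text \<open>
  The auxiliary equations are a Knuth--Bendix completion of the presentation by \<open>s\<close> and \<open>m\<close>, pruned
  to the rules that are needed to bring both sides of the table to normal form. The same holds for
  the two tables below.
\<close>

lemma table_holt:
  fixes s m M :: "'b \<Rightarrow> 'b"
  assumes ss: "\<And>x. s (s x) = x" and mM: "\<And>x. m (M x) = x" and Mm: "\<And>x. M (m x) = x"
    and rel: "\<And>x. s (m (m (m (s (M (s (m x))))))) = x"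
  defines "R \<equiv> \<lambda>e. [e, M (s (M (M e))), m (s (M (s e))), M (M (s (m (m e)))),
      M (s (m e)), m (m (m e)), m (m (s (M (M e)))), m (s (M e)),
      m (m (s (m e))), m (s (M (s (M e)))), M (s e), m (s (m (s e))),
      m (m (s e)), M (s (m (m (m e)))), M (M (s (m e))), m (m e),
      m (s (m e)), M e, m (m (s (m (m e)))), M (s (m (m e))),
      m e, M (M e), M (s (M e)), m (m (s (M e))),
      M (M (s e)), m (s e), M (s (m (m (s e))))]"
  shows "map m (arc_list s (R e)) = map ((!) (arc_list s (R e))) holt_code"
proof -
  have r1: "s (m (m (m (s (M (s (m x))))))) = x" for x by (metis rel)
  have r2: "m (m (m (s (M (s (m x)))))) = s x" for x by (metis ss r1)
  have r3: "s (m (m (m (s (M (s x)))))) = M x" for x by (metis r1 mM)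
  have r4: "s (m (m (m (s (M x))))) = m (m (s (M (s (m x)))))" for x by (metis r1)
  have r5: "m (m (s (M (s (m (s x)))))) = M x" for x by (metis r3 r4)
  have r6: "m (m (s (M (s (m x))))) = M (s x)" for x by (metis Mm r2)
  have r7: "m (s (M (s (m (s x))))) = M (M x)" for x by (metis Mm r5)
  have r8: "m (m (m (s (M x)))) = s (M (s x))" for x by (metis ss r4 r6)
  have r9: "s (m (m (m (s x)))) = M (s (m x))" for x by (metis r4 Mm r6)
  have r10: "m (m (m (s (m (s (M (s (m x)))))))) = s (m (m (s (M x))))" for x by (metis r2 r4 Mm)
  have r11: "s (M (s (m x))) = m (m (m (s x)))" for x by (metis ss r9)
  have r12: "M (M (M x)) = m (m (m x))" for x by (metis Mm r7 r11 ss)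
  have r13: "M (s (M (s x))) = m (m (s (M x)))" for x by (metis Mm r8)
  have r14: "m (m (s (M (s x)))) = M (s (M x))" for x by (metis r6 mM)
  have r15: "M (s (m (s x))) = s (m (m (m x)))" for x by (metis r9 ss)
  have r16: "m (m (m (m x))) = M (M x)" for x by (metis r7 r11 ss)
  have r17: "m (m (s (M (M (s (m x)))))) = M (s (m (m (s x))))" for x by (metis r6 r9)
  have r18: "m (s (M (s (M (M x))))) = m (m (m (s (m (s x)))))" for x by (metis r7 r12)
  have r19: "M (s (m (m (s (M x))))) = m (m (s (M (M (s x)))))" for x by (metis Mm r10 r11 r16)
  have r20: "m (m (s (m (m (s (M x)))))) = M (s (M (M (s x))))" for x by (metis r6 r11 r16 r13)
  have r21: "M (s (M (M (s x)))) = s (m (m (s (m x))))" for x by (metis r9 r16 mM)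
  have r22: "m (m (s (m (m (s (M x)))))) = s (m (m (s (m x))))" for x by (metis r20 r21)
  have r23: "s (m (m (s (m (m x))))) = m (m (s (m (m (s x)))))" for x by (metis r10 r7 r11 ss Mm r18 r9 mM)
  have r24: "m (s (m (m (m x)))) = s (m (s x))" for x by (metis mM r15)
  have r25: "m (s (m (m (s (m x))))) = s (M (M (s x)))" for x by (metis mM r21)
  have r26: "M (M (s (m (m (s x))))) = m (s (M (M (s (m x)))))" for x by (metis Mm r17)
  have r27: "s (M (s (M (M x)))) = m (m (s (m (s x))))" for x by (metis Mm r18)
  have r28: "m (m (m (s (m (m (s x)))))) = s (M (M (s (m x))))" for x by (metis r11 r9)
  have r29: "m (s (M (M (s (m (m x)))))) = s (m (m (s (M x))))" for x by (metis r12 r21 r8 r13 r26)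
  have r30: "s (m (s (m x))) = m (s (M (M x)))" for x by (metis r23 r9 r25 ss mM)
  have r31: "s (m (m (s (M (M x))))) = m (s (M (M (s (m x)))))" for x by (metis r23 r16 r26)
  have r32: "s (m (s (M x))) = m (s (m (m x)))" for x by (metis r8 r19 ss Mm r22 mM)
  have r33: "s (M (M (s (m (m x))))) = m (m (s (M (M (s x)))))" for x by (metis Mm r29 r19)
  \<comment> \<open>Only the rules listed here rewrite the table; the remaining ones are stages in
    their derivation.\<close>
  show ?thesis
    unfolding arc_list_def R_def holt_code_def
    by (simp add: ss mM Mm r8 r11 r13 r14 r15 r16 r17 r22 r23 r24 r25 r27 r28 r30 r31 r32 r33)
qed

text \<open>The digits 41, and below 32 and 2111, are the lengths of the directed segments around
  the pentagon. Vertices 0 to 11 become the \<open>Rose_x\<close> vertices of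
  \<open>rose_window 12 5 2\<close>, and 12 to 23 the \<open>Rose_y\<close> vertices.\<close>

definition rose41_code :: "nat list" where
  "rose41_code =
    [38, 22, 0, 40, 3, 43, 5, 45, 47, 7, 24, 8, 26, 10, 12, 28, 15, 31, 17, 33, 35, 19, 36,
    20, 1, 29, 2, 30, 4, 32, 34, 6, 37, 9, 39, 11, 13, 41, 14, 42, 16, 44, 46, 18, 25, 21,
    27, 23]"

lemma table_rose41:
  fixes s m M :: "'b \<Rightarrow> 'b"
  assumes ss: "\<And>x. s (s x) = x" and mM: "\<And>x. m (M x) = x" and Mm: "\<And>x. M (m x) = x"
    and rel: "\<And>x. s (m (m (s (m (s (M (s (m x)))))))) = x"
  defines "R \<equiv> \<lambda>e. [e, M e, M (s (M e)), M (s (M (s (M e)))),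
      M (M (s (m (s e)))), M (M (s e)), M (M (M e)), m (m e),
      M (s (m (m e))), m (s (m (s (m e)))), m (s (m (s e))), m (s e),
      M (s e), M (M e), M (M (s (M e))), M (M (s (m e))),
      M (s (m (m (s e)))), M (s (m e)), m (m (s e)), m e,
      m (s (M e)), m (s (m e)), M (s (M (s e))), M (s (M (M e)))]"
  shows "map m (arc_list s (R e)) = map ((!) (arc_list s (R e))) rose41_code"
proof -
  have r1: "s (m (m (s (m (s (M (s (m x)))))))) = x" for x by (metis rel)
  have r2: "m (m (s (m (s (M (s (m x))))))) = s x" for x by (metis ss r1)
  have r3: "s (m (m (s (m (s (M (s x))))))) = M x" for x by (metis r1 mM)
  have r4: "m (s (m (s (M (s (m x)))))) = s (m (m (s (m (s (M x))))))" for x by (metis r1)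
  have r5: "m (s (m (m (s (m (s (M x))))))) = s x" for x by (metis r2 r4)
  have r6: "s (m (m (s (m (s (M x)))))) = M (s x)" for x by (metis Mm r5)
  have r7: "m (s (m (m (s (m (s x)))))) = s (m x)" for x by (metis r5 Mm)
  have r8: "s (m (s (M (s (m x))))) = M (M (s x))" for x by (metis Mm r4 r6)
  have r9: "m (s (m (s (M (s x))))) = M (s (M x))" for x by (metis r4 mM r6)
  have r10: "s (m (m (s (m (m (s (M (s x)))))))) = m (s (m (s (M (M x)))))" for x by (metis r4 r3 Mm ss)
  have r11: "m (s (m (s (m (s (m (s (M x)))))))) = s (M (s (m x)))" for x by (metis r4 r6 ss Mm)
  have r12: "m (s (M (s (m x)))) = s (M (M (s x)))" for x by (metis ss r8)
  have r13: "s (m (m (s (m (s x))))) = M (s (m x))" for x by (metis Mm r7)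
  have r14: "s (m (s (M (s x)))) = M (M (s (M x)))" for x by (metis Mm r9)
  have r15: "m (s (m (m (s (m x))))) = s (m (s x))" for x by (metis r7 ss)
  have r16: "m (s (m (s (M x)))) = M (s (M (s x)))" for x by (metis r9 ss)
  have r17: "s (M (s (m (s x)))) = M (s (M (M x)))" for x by (metis r11 r9 r14 mM)
  have r18: "m (s (m (s (m (s (m (s x))))))) = s (M (s (m (m x))))" for x by (metis r11 Mm)
  have r19: "M (s (M (M (s x)))) = s (M (s (m x)))" for x by (metis r11 r16 r14 mM)
  have r20: "m (s (m (m (s (M (s (M x))))))) = s (m (m (s (M (s x)))))" for x by (metis r7 r9)
  have r21: "M (M (s (M (s (M (s x)))))) = s (m (s (M (M (s x)))))" for x by (metis r8 r6 r16)
  have r22: "m (m (s (m (m (s (M (s x))))))) = s (M (s (M (s (M x)))))" for x by (metis ss r10 r16)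
  have r23: "m (s (m (m x))) = M (M (s (M x)))" for x by (metis r7 r6 r16 mM r14 ss)
  have r24: "M (M (s (M (s (m x))))) = s (m (s x))" for x by (metis r15 r23)
  have r25: "s (m (s (M (M (s (M x)))))) = s (m (m (s (M (s x)))))" for x by (metis r20 r23 r21)
  have r26: "M (s (M (s (M (s x))))) = s (M (s (M (s (M x)))))" for x by (metis r22 r23 mM)
  have r27: "s (M (s (M (s (M (M x)))))) = s (m (s (M (M (s x)))))" for x by (metis r21 r26)
  have r28: "M (s (m (m (s (M x))))) = m (s (m (s (m x))))" for x by (metis r7 r11 r13 ss mM)
  have r29: "s (m (m (s (M x)))) = s (M (s (m (m x))))" for x by (metis r10 r8 Mm r14 mM r19 r23 r27 r25 ss)
  have r30: "M (s (M (s (m (m x))))) = m (s (m (s (m x))))" for x by (metis r28 r29)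
  have r31: "M (M (M (s x))) = s (M (M (M x)))" for x by (metis r10 Mm ss r23 mM)
  have r32: "M (M (s (M (M x)))) = m (s (m x))" for x by (metis r23 mM)
  have r33: "m (m (s (m (s x)))) = s (M (s (m x)))" for x by (metis ss r13)
  have r34: "s (M (M (s (M x)))) = m (s (M (s x)))" for x by (metis ss r14)
  have r35: "s (M (s (M (M x)))) = M (s (m (s x)))" for x by (metis ss r17)
  have r36: "M (s (M (s (m x)))) = m (s (m (s x)))" for x by (metis mM r24)
  have r37: "M (M (s (M (s x)))) = s (m (s (M x)))" for x by (metis Mm r16)
  have r38: "m (m (s (M x))) = M (s (m (m x)))" for x by (metis ss r29)
  have r39: "m (s (M (s (M x)))) = s (m (s (m x)))" for x by (metis r23 r36 Mm mM)
  have r40: "m (s (M (M x))) = M (M (s (m x)))" for x by (metis r16 r31 r19 ss mM)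
  have r41: "M (s (m (s (m x)))) = s (M (s (M x)))" for x by (metis r31 r30 Mm)
  have r42: "m (s (m (s (m (s x))))) = s (m (s (m (s (m x)))))" for x by (metis r13 r14 r38 r36 mM)
  have r43: "m (m (m x)) = M (M (M x))" for x by (metis r18 r33 r12 ss r31 mM)
  have r44: "m (m (s (m x))) = M (s (M (M x)))" for x by (metis mM r32)
  show ?thesis
    unfolding arc_list_def R_def rose41_code_def
    by (simp add: ss mM Mm r12 r16 r19 r23 r26 r31 r34 r35 r37 r38 r39 r40 r41 r42 r43 r44)
qed

text \<open>A second description of \<open>rose_window 12 5 2\<close>, coming from the pentagon with
  segments of lengths 3 and 2.\<close>

definition rose32_code :: "nat list" where
  "rose32_code =
    [38, 24, 0, 4, 28, 43, 5, 9, 46, 33, 13, 8, 26, 36, 12, 16, 40, 31, 17, 21, 35, 45, 1,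
    20, 10, 29, 2, 47, 15, 32, 27, 6, 37, 19, 30, 11, 22, 41, 14, 34, 3, 44, 39, 18, 25, 7,
    23, 42]"

lemma table_rose32:
  fixes s m M :: "'b \<Rightarrow> 'b"
  assumes ss: "\<And>x. s (s x) = x" and mM: "\<And>x. m (M x) = x" and Mm: "\<And>x. M (m x) = x"
    and rel: "\<And>x. s (m (s (m (s (M (M (s (m x)))))))) = x"
  defines "R \<equiv> \<lambda>e. [e, M e, m (s (M e)), M (s (m (s (M e)))),
      M (M (s (M (s e)))), m (m (s e)), M (M (M e)), m (m e),
      M (M (s (M e))), m (s (M (s (m e)))), m (s (M (s e))), M (s e),
      m (s e), M (M e), M (s (m (m e))), M (s (M (M e))),
      M (s (M (M (s e)))), m (s (m e)), M (M (s e)), m e,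
      M (s (M e)), M (s (m e)), M (s (m (s e))), M (s (M (s e)))]"
  shows "map m (arc_list s (R e)) = map ((!) (arc_list s (R e))) rose32_code"
proof -
  have r1: "s (m (s (m (s (M (M (s (m x)))))))) = x" for x by (metis rel)
  have r2: "m (s (m (s (M (M (s (m x))))))) = s x" for x by (metis ss r1)
  have r3: "s (m (s (m (s (M (M (s x))))))) = M x" for x by (metis r1 mM)
  have r4: "s (m (s (m (s (M (M x)))))) = s (m (s (M (M (s (m x))))))" for x by (metis r1)
  have r5: "s (m (s (M (M (s (m (s x))))))) = M x" for x by (metis r3 r4)
  have r6: "m (s (M (M (s (m (s x)))))) = s (M x)" for x by (metis ss r5)
  have r7: "s (m (s (M (M (s (m x)))))) = M (s x)" for x by (metis Mm r2)
  have r8: "M (M (M (s (m (s x))))) = s (m (s (M (M (M x)))))" for x by (metis r5)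
  have r9: "m (s (m (s (M (M x))))) = m (s (M (M (s (m x)))))" for x by (metis ss r4)
  have r10: "m (s (M (M (s x)))) = M (M (s (m (s x))))" for x by (metis r2 r5 ss r9 mM)
  have r11: "M (M (s (m (s (m (s x)))))) = s (M x)" for x by (metis r6 r10)
  have r12: "s (M (M (s (m (s (m x)))))) = M (s x)" for x by (metis r7 r10)
  have r13: "s (m (s (m (s (M x))))) = M (s (m x))" for x by (metis r4 Mm r10 r12)
  have r14: "s (m (s (M (M x)))) = s (M (M (s (m x))))" for x by (metis r5 r2 Mm ss)
  have r15: "M (M (M (s (m (s x))))) = s (M (M (s x)))" for x by (metis r8 r14 mM)
  have r16: "m (s (M (M x))) = M (M (s (m x)))" for x by (metis r2 r4 ss r10 r11 Mm)
  have r17: "M (M (s (m (m x)))) = m (s (M x))" for x by (metis r16 Mm)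
  have r18: "M (M (s (m (s (m x))))) = s (M (s x))" for x by (metis ss r12)
  have r19: "m (s (m (s (M x)))) = s (M (s (m x)))" for x by (metis ss r13)
  have r20: "s (M (M (s (m (s x))))) = M (s (M x))" for x by (metis r15 r11)
  have r21: "s (m (s (m (s x)))) = M (s (m (m x)))" for x by (metis r13 Mm)
  have r22: "M (M (M (s x))) = s (M (M (M x)))" for x by (metis r11 r16 r18 ss)
  have r23: "m (s (M (s (M x)))) = M (s (m (s x)))" for x by (metis r16 r11 mM ss Mm)
  have r24: "M (s (M (s (m (s x))))) = s (m (s (M (s x))))" for x by (metis r13 r15 mM ss)
  have r25: "m (m (s (M x))) = M (s (m (m x)))" for x by (metis mM r17)
  have r26: "M (M (s (m (s x)))) = s (M (s (M x)))" for x by (metis ss r20)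
  have r27: "s (M (s (m (m x)))) = m (s (m (s x)))" for x by (metis ss r21)
  have r28: "M (s (m (s (m x)))) = m (s (M (s x)))" for x by (metis mM r18)
  have r29: "M (s (M (s (m x)))) = s (m (s (M x)))" for x by (metis Mm r19)
  have r30: "s (M (M (s (m x)))) = M (s (M (s x)))" for x by (metis r20 ss)
  have r31: "M (s (m (m (s x)))) = s (m (s (m x)))" for x by (metis r21 ss)
  have r32: "m (s (M (s (m (s x))))) = s (M (s (m (s (M x)))))" for x by (metis r19 r23)
  have r33: "s (M (s (M (s x)))) = M (M (s (m x)))" for x by (metis r19 r22 mM ss r16)
  have r34: "m (m (s (m x))) = M (s (M (M x)))" for x by (metis r19 r24 r32 ss r26 r25 r27)
  have r35: "m (s (m (s (m x)))) = s (m (m (s x)))" for x by (metis mM r31)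
  have r36: "M (s (M (s (M x)))) = s (M (M (s x)))" for x by (metis r30 mM)
  have r37: "M (s (m (s (M (s x))))) = s (m (s (M (s (m x)))))" for x by (metis r29 r28)
  have r38: "m (s (m (m x))) = M (M (s (M x)))" for x by (metis r27 r34 ss r33 mM)
  have r39: "M (M (M (M x))) = m (m x)" for x by (metis r17 r34 Mm ss mM)
  have r40: "m (m (m x)) = M (M (M x))" for x by (metis mM r39)
  show ?thesis
    unfolding arc_list_def R_def rose32_code_def
    by (simp add: ss mM Mm r16 r19 r22 r23 r25 r26 r27 r28 r30 r31 r32 r33 r34 r35 r36 r37 r38
        r40)
qed

section \<open>The successor map and its relations with \<open>sib\<close>\<close>

definition (in arc_transitive_orientation) classified :: bool where
  "classified \<longleftrightarrow> coded_by holt_code V (D\<^sup>s) \<or> coded_by rose41_code V (D\<^sup>s) \<or>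
     coded_by rose32_code V (D\<^sup>s)"

text \<open>Since \<open>m\<close> is the identity outside \<open>D\<close>, the equations
  \<open>mM\<close> and \<open>Mm\<close> hold on the whole type, as the hypotheses of the three
  tables demand.\<close>

locale orientation_with_successor = arc_transitive_orientation V D G
  for V :: "'a set" and D G +
  fixes m M :: "'a \<times> 'a \<Rightarrow> 'a \<times> 'a"
  assumes m_equivariant: "equivariant m"
    and m_successor: "e \<in> D \<Longrightarrow> fst (m e) = snd e"
    and m_off: "e \<notin> D \<Longrightarrow> m e = e"
    and mM: "m (M e) = e"
    and Mm: "M (m e) = e"
begin

lemma m_in: "e \<in> D \<Longrightarrow> m e \<in> D"
  using equivariantD(1)[OF m_equivariant] .

lemma M_in: "e \<in> D \<Longrightarrow> M e \<in> D"
  by (metis mM m_off)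

lemma M_off: "e \<notin> D \<Longrightarrow> M e = e"
  using Mm[of e] m_off[of e] by simp

lemma M_equivariant: "equivariant M"
  unfolding equivariant_def
proof (intro ballI conjI)
  fix e g assume "e \<in> D" "g \<in> G"
  then have "m (map_prod g g (M e)) = map_prod g g e"
    using equivariantD(2)[OF m_equivariant M_in] mM by simp
  then show "M (map_prod g g e) = map_prod g g (M e)" by (metis Mm)
qed (rule M_in)

text \<open>
  Being the identity outside \<open>D\<close> lets relations between these maps be stated without side conditions.
\<close>

definition uniform :: "('a \<times> 'a \<Rightarrow> 'a \<times> 'a) \<Rightarrow> bool" where
  "uniform f \<longleftrightarrow> equivariant f \<and> (\<forall>e. e \<notin> D \<longrightarrow> f e = e)"

lemma uniform_intros:
  "uniform (\<lambda>e. e)"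
  "uniform f \<Longrightarrow> uniform (\<lambda>e. sib (f e))"
  "uniform f \<Longrightarrow> uniform (\<lambda>e. cosib (f e))"
  "uniform f \<Longrightarrow> uniform (\<lambda>e. m (f e))"
proof -
  show "uniform (\<lambda>e. e)" by (simp add: uniform_def equivariant_def)
  assume f: "uniform f"
  then have eq: "equivariant f" and off: "\<And>e. e \<notin> D \<Longrightarrow> f e = e"
    unfolding uniform_def by blast+
  show "uniform (\<lambda>e. sib (f e))"
    unfolding uniform_def using equivariant_comp[OF equivariant_sib eq] off by (simp add: sib_def)
  show "uniform (\<lambda>e. cosib (f e))"
    unfolding uniform_def using equivariant_comp[OF equivariant_cosib eq] off by (simp add: cosib_def)
  show "uniform (\<lambda>e. m (f e))"
    unfolding uniform_def using equivariant_comp[OF m_equivariant eq] off by (simp add: m_off)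
qed

lemma uniform_eq:
  "uniform f \<Longrightarrow> uniform f' \<Longrightarrow> e\<^sub>0 \<in> D \<Longrightarrow> f e\<^sub>0 = f' e\<^sub>0 \<Longrightarrow> f x = f' x"
  using equivariant_agree[of f f' e\<^sub>0 x] unfolding uniform_def by (cases "x \<in> D") (simp, metis)

lemma next_arc: "e \<in> D \<Longrightarrow> f \<in> D \<Longrightarrow> fst f = snd e \<Longrightarrow> f = m e \<or> f = sib (m e)"
  by (rule same_tail[OF m_in]) (simp_all add: m_successor)

text \<open>Being injective, \<open>m\<close> carries the two arcs that end at a vertex to the two
  arcs that start there, so it conjugates the involution \<open>cosib\<close> to
  \<open>sib\<close>.\<close>

lemma cosib_conv: "cosib x = M (sib (m x))"
proof (cases "x \<in> D")
  case True
  then have "m (cosib x) = m x \<or> m (cosib x) = sib (m x)"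
    using next_arc[of x "m (cosib x)"] m_in m_successor cosib_simps by simp
  moreover have "m (cosib x) \<noteq> m x" using cosib_simps(4)[OF True] by (metis Mm)
  ultimately have "m (cosib x) = sib (m x)" by blast
  then show ?thesis using Mm[of "cosib x"] by simp
next
  case False
  then show ?thesis by (simp add: m_off M_off sib_def cosib_def)
qed

lemma obtain_arc: obtains e where "e \<in> D" using D_nonempty by auto

text \<open>The relation says that conjugation by \<open>sib\<close> inverts \<open>m\<close>. Then
  \<open>m\<close> maps \<open>sib (m e)\<close> to \<open>sib e\<close>, whose tail is the tail of
  \<open>e\<close>, so \<open>sib (m e)\<close> is the reverse of \<open>e\<close>.\<close>

lemma not_dihedral: "\<not> (\<forall>x. m (sib x) = sib (M x))"
proof
  assume *: "\<forall>x. m (sib x) = sib (M x)"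
  obtain e where e: "e \<in> D" by (rule obtain_arc)
  let ?f = "sib (m e)"
  have f: "?f \<in> D" "fst ?f = snd e" using e by (simp_all add: m_in sib_simps m_successor)
  have "snd ?f = fst (m ?f)" using m_successor[OF f(1)] by simp
  also have "m ?f = sib e" using spec[OF *, of "m e"] Mm by simp
  also have "fst (sib e) = fst e" using sib_simps(2)[OF e] .
  finally have "?f = (snd e, fst e)" using f(2) by (simp add: prod_eq_iff)
  then show False using f(1) e asym by (metis prod.collapse)
qed

lemma not_successor_eq_sib: "\<not> (\<forall>x. m x = sib x)"
proof
  assume *: "\<forall>x. m x = sib x"
  obtain e where e: "e \<in> D" by (rule obtain_arc)
  then have "fst e = snd e" using m_successor[OF e] sib_simps(2)[OF e] * by simp
  then show False using e asym by (metis prod.collapse)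
qed

text \<open>The relation says that \<open>m\<close> commutes with its conjugate by
  \<open>sib\<close>. It makes the path \<open>e\<close>, \<open>sib (m e)\<close> and the path
  \<open>sib e\<close>, \<open>sib (m (sib e))\<close> end at the same vertex, which gives a
  square.\<close>

lemma not_commuting: "\<not> (\<forall>x. m (sib (m x)) = sib (m (sib (m (sib x)))))"
proof
  assume *: "\<forall>x. m (sib (m x)) = sib (m (sib (m (sib x))))"
  obtain e where e: "e \<in> D" by (rule obtain_arc)
  let ?f = "sib (m e)" and ?g = "sib (m (sib e))"
  have D: "sib e \<in> D" "?f \<in> D" "?g \<in> D" using e by (simp_all add: m_in sib_simps)
  have f: "fst ?f = snd e" and g: "fst ?g = snd (sib e)"
    using e by (simp_all add: m_in sib_simps m_successor)
  have "snd ?f = fst (m ?f)" using m_successor[OF D(2)] by simp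
  also have "\<dots> = fst (m ?g)" using spec[OF *, of e] sib_simps(2)[OF m_in[OF D(3)]] by simp
  also have "\<dots> = snd ?g" using m_successor[OF D(3)] by simp
  finally have fg: "snd ?f = snd ?g" .
  have arcs: "(fst e, snd e) \<in> D" "(snd e, snd ?f) \<in> D" "(snd (sib e), snd ?f) \<in> D"
    "(fst e, snd (sib e)) \<in> D"
    using e D f g fg sib_simps(2)[OF e] by (metis prod.collapse)+
  then have "fst e = snd ?f \<or> snd e = snd (sib e)"
    using no_square[of "fst e" "snd e" "snd ?f" "snd (sib e)"] by (simp add: in_symcl_iff del: prod.collapse)
  then show False using arcs(1,2) asym sib_simps(3)[OF e] by metis
qed

lemma m_bij: "bij_betw m D D" and M_bij: "bij_betw M D D"
  using equivariant_bij m_equivariant M_equivariant by auto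

lemma M_predecessor: "e \<in> D \<Longrightarrow> snd (M e) = fst e"
  using m_successor[OF M_in] mM by simp

text \<open>
  The second relation is the first one with \<open>m\<close> and its inverse interchanged, which corresponds to reversing
  the orientation.
\<close>

lemma classified_holt:
  assumes "(\<forall>x. M (sib (m x)) = sib (m (m (m (sib x))))) \<or>
    (\<forall>x. M (sib (m x)) = m (m (sib (m (sib x)))))"
  shows "coded_by holt_code V (D\<^sup>s)"
proof -
  obtain e where e: "e \<in> D" by (rule obtain_arc)
  note simps = holt_code_def e m_in M_in sib_simps
  from assms show ?thesis
  proof
    assume *: "\<forall>x. M (sib (m x)) = sib (m (m (m (sib x))))"
    have "sib (m (m (m (sib (M (sib (m x))))))) = x" for x
      by (metis * sib_sib mM Mm)
    note table = table_holt[of sib m M, OF sib_sib mM Mm this]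
    show ?thesis
      by (rule coded_by_table[OF m_bij _ _ _ _ _ _ _ table[of e]]) (simp_all add: simps m_successor)
  next
    assume *: "\<forall>x. M (sib (m x)) = m (m (sib (m (sib x))))"
    have "sib (M (M (M (sib (m (sib (M x))))))) = x" for x
      by (metis * sib_sib mM Mm)
    note table = table_holt[of sib M m, OF sib_sib Mm mM this]
    show ?thesis
      by (rule coded_by_table[OF M_bij _ _ _ _ _ _ _ table[of e]]) (simp_all add: simps M_predecessor)
  qed
qed

lemma classified_rose41:
  assumes *: "\<forall>x. M (sib (m x)) = sib (m (m (sib (m (sib x)))))"
  shows "coded_by rose41_code V (D\<^sup>s)"
proof -
  obtain e where e: "e \<in> D" by (rule obtain_arc)
  have "sib (m (m (sib (m (sib (M (sib (m x)))))))) = x" for x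
    by (metis * sib_sib mM Mm)
  note table = table_rose41[of sib m M, OF sib_sib mM Mm this]
  show ?thesis
    by (rule coded_by_table[OF m_bij _ _ _ _ _ _ _ table[of e]])
      (simp_all add: rose41_code_def e m_in M_in sib_simps m_successor)
qed

lemma classified_rose32:
  assumes *: "\<forall>x. M (sib (m (m x))) = sib (m (sib (m (sib x))))"
  shows "coded_by rose32_code V (D\<^sup>s)"
proof -
  obtain e where e: "e \<in> D" by (rule obtain_arc)
  have "sib (m (sib (m (sib (M (M (sib (m x)))))))) = x" for x
    by (metis * sib_sib mM Mm)
  note table = table_rose32[of sib m M, OF sib_sib mM Mm this]
  show ?thesis
    by (rule coded_by_table[OF m_bij _ _ _ _ _ _ _ table[of e]])
      (simp_all add: rose32_code_def e m_in M_in sib_simps m_successor)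
qed

text \<open>Here \<open>e\<close> is the arc that closes a directed path of length 4 to a pentagon,
  and \<open>sib e\<close> and \<open>cosib e\<close> are the first and the last arc of that path.
  By \<open>mb\<close> the middle step is \<open>m\<close>, so two binary choices remain and
  \<open>cosib e\<close> is one of four words applied to \<open>e\<close>. As both sides are
  equivariant, the equation spreads from \<open>e\<close> to all arcs.\<close>

lemma relation_41:
  assumes e: "e \<in> D" and b: "(snd (sib e), b) \<in> D" "(b, fst (cosib e)) \<in> D"
    and mb: "m (snd (sib e), b) = (b, fst (cosib e))"
  shows classified
proof -
  define f where "f = (snd (sib e), b)"
  have lift: "M (sib (m x)) = w x"
    if "cosib e = w e" "uniform w" for w x
    using uniform_eq[OF uniform_intros(3)[OF uniform_intros(1)] that(2) e that(1)] cosib_conv by simp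
  have "f = m (sib e) \<or> f = sib (m (sib e))"
    unfolding f_def by (rule next_arc[OF sib_simps(1)[OF e] b(1)]) simp
  moreover have "cosib e = m (m f) \<or> cosib e = sib (m (m f))"
    unfolding f_def by (rule next_arc[OF m_in[OF b(1)] cosib_simps(1)[OF e]]) (simp add: mb)
  ultimately consider
      "cosib e = m (m (m (sib e)))" | "cosib e = sib (m (m (m (sib e))))"
    | "cosib e = m (m (sib (m (sib e))))" | "cosib e = sib (m (m (sib (m (sib e)))))"
    by auto
  then show ?thesis
  proof cases
    case 1
    have "M (sib (m x)) = m (m (m (sib x)))" for x
      by (rule lift[of "\<lambda>x. m (m (m (sib x)))", OF 1]) (intro uniform_intros)
    \<comment> \<open>This relation says that conjugation by \<open>sib\<close> takes
      \<open>m\<close> to its fourth power, which commutes with \<open>m\<close>.\<close>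
    then have "\<forall>x. m (sib (m x)) = sib (m (sib (m (sib x))))"
      by (metis sib_sib mM Mm)
    then show ?thesis using not_commuting by blast
  next
    case 2
    have "M (sib (m x)) = sib (m (m (m (sib x))))" for x
      by (rule lift[of "\<lambda>x. sib (m (m (m (sib x))))", OF 2]) (intro uniform_intros)
    then show ?thesis using classified_holt classified_def by blast
  next
    case 3
    have "M (sib (m x)) = m (m (sib (m (sib x))))" for x
      by (rule lift[of "\<lambda>x. m (m (sib (m (sib x))))", OF 3]) (intro uniform_intros)
    then show ?thesis using classified_holt classified_def by blast
  next
    case 4
    have "M (sib (m x)) = sib (m (m (sib (m (sib x)))))" for x
      by (rule lift[of "\<lambda>x. sib (m (m (sib (m (sib x)))))", OF 4]) (intro uniform_intros)
    then show ?thesis using classified_rose41 classified_def by blast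
  qed
qed

text \<open>Now \<open>e\<close> and \<open>m e\<close> form the side of length 2, and the side of
  length 3 starts with \<open>sib e\<close> and ends with \<open>cosib (m e)\<close>. Two binary
  choices along the longer side leave four words for \<open>cosib (m e)\<close>; only the last is
  compatible with the girth.\<close>

lemma relation_32:
  assumes e: "e \<in> D" and ab: "(snd (sib e), fst (cosib (m e))) \<in> D"
  shows classified
proof -
  define f where "f = (snd (sib e), fst (cosib (m e)))"
  have lift: "M (sib (m (m x))) = w x"
    if "cosib (m e) = w e" "uniform w" for w x
    using uniform_eq[OF uniform_intros(3)[OF uniform_intros(4)[OF uniform_intros(1)]] that(2) e that(1)]
      cosib_conv by simp
  have "f = m (sib e) \<or> f = sib (m (sib e))"
    unfolding f_def by (rule next_arc[OF sib_simps(1)[OF e] ab]) simp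
  moreover have "cosib (m e) = m f \<or> cosib (m e) = sib (m f)"
    unfolding f_def by (rule next_arc[OF ab cosib_simps(1)[OF m_in[OF e]]]) simp
  ultimately consider
      "cosib (m e) = m (m (sib e))" | "cosib (m e) = sib (m (m (sib e)))"
    | "cosib (m e) = m (sib (m (sib e)))" | "cosib (m e) = sib (m (sib (m (sib e))))"
    by auto
  then show ?thesis
  proof cases
    case 1
    have "M (sib (m (m x))) = m (m (sib x))" for x
      by (rule lift[of "\<lambda>x. m (m (sib x))", OF 1]) (intro uniform_intros)
    \<comment> \<open>Write s for \<open>sib\<close>. The relation says s m^2 s = m^3, and
      conjugating it by s gives s m^3 s = m^2. Dividing the second by the first yields s m s =
      m^-1.\<close>
    then have "\<forall>x. m (sib x) = sib (M x)"
      by (metis sib_sib mM Mm)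
    then show ?thesis using not_dihedral by blast
  next
    case 2
    have "M (sib (m (m x))) = sib (m (m (sib x)))" for x
      by (rule lift[of "\<lambda>x. sib (m (m (sib x)))", OF 2]) (intro uniform_intros)
    \<comment> \<open>The relation gives s m^2 s = m^-1 s m^2 and, after multiplication by s, also s
      m^2 s = m s m^2. Hence m^2 = 1, and what remains is m = s.\<close>
    then have "\<forall>x. m x = sib x" by (metis sib_sib mM Mm)
    then show ?thesis using not_successor_eq_sib by blast
  next
    case 3
    have "M (sib (m (m x))) = m (sib (m (sib x)))" for x
      by (rule lift[of "\<lambda>x. m (sib (m (sib x)))", OF 3]) (intro uniform_intros)
    \<comment> \<open>The relation says s m s = m^-2 s m^2, a conjugate of the involution s. Hence
      m^2 = 1, and the relation becomes m = s.\<close>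
    then have "\<forall>x. m x = sib x" by (metis sib_sib mM Mm)
    then show ?thesis using not_successor_eq_sib by blast
  next
    case 4
    have "M (sib (m (m x))) = sib (m (sib (m (sib x))))" for x
      by (rule lift[of "\<lambda>x. sib (m (sib (m (sib x))))", OF 4]) (intro uniform_intros)
    then show ?thesis using classified_rose32 classified_def by blast
  qed
qed

lemma relation_2111:
  assumes e: "e \<in> D" and "m e = cosib (sib (cosib (sib e)))"
  shows False
proof -
  have "m x = cosib (sib (cosib (sib x)))" for x
    by (rule uniform_eq[of m "\<lambda>x. cosib (sib (cosib (sib x)))", OF _ _ e assms(2)])
      (intro uniform_intros)+
  then have "m x = M (sib (m (sib (M (sib (m (sib x)))))))" for x
    unfolding cosib_conv .
  \<comment> \<open>With b = s m s the relation reads m^2 = b m^-1 b, and its conjugate by s reads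
    b^2 = m b^-1 m. Therefore b = m b^-1 m^2 = b^2 m, that is b = m^-1.\<close>
  then have "\<forall>x. m (sib x) = sib (M x)"
    by (metis sib_sib mM Mm)
  then show ?thesis using not_dihedral by blast
qed

end

section \<open>Undirected pentagons\<close>

context arc_transitive_orientation
begin

lemma obtain_successor:
  assumes f: "equivariant f" and succ: "\<And>e. e \<in> D \<Longrightarrow> fst (f e) = snd e"
  obtains m M where "orientation_with_successor V D G m M" "\<And>e. e \<in> D \<Longrightarrow> m e = f e"
proof -
  have bij: "bij_betw f D D" using f by (rule equivariant_bij)
  then have inj: "inj_on f D" and im: "f ` D = D" by (auto simp: bij_betw_def)
  define m where "m e = (if e \<in> D then f e else e)" for e
  define M where "M e = (if e \<in> D then the_inv_into D f e else e)" for e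
  have fD: "f e \<in> D" if "e \<in> D" for e using equivariantD(1)[OF f that] .
  have iD: "the_inv_into D f e \<in> D" if "e \<in> D" for e
    using the_inv_into_into[OF inj] that im by simp
  have "orientation_with_successor V D G m M"
  proof unfold_locales
    show "equivariant m"
      using f G_arc' unfolding equivariant_def m_def by simp
    show "fst (m e) = snd e" if "e \<in> D" for e using succ that by (simp add: m_def)
    show "m e = e" if "e \<notin> D" for e using that by (simp add: m_def)
    show "m (M e) = e" for e
      using iD f_the_inv_into_f[OF inj] im by (simp add: m_def M_def)
    show "M (m e) = e" for e
      using fD the_inv_into_f_f[OF inj] by (simp add: m_def M_def)
  qed
  then show ?thesis using that by (simp add: m_def)
qed

text \<open>The arc \<open>(a, e)\<close> determines \<open>(b, c)\<close>, because a second choice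
  of \<open>c\<close> would give a square with \<open>b\<close> and \<open>d\<close>. So there are
  equivariant maps \<open>\<beta>\<close> and \<open>\<gamma>\<close> sending \<open>(a, e)\<close>
  to the second and to the third arc of the path, and \<open>\<gamma>\<close> after the inverse of
  \<open>\<beta>\<close> is a successor map.\<close>

lemma classified_if_pattern_41:
  assumes "(a, b) \<in> D" "(b, c) \<in> D" "(c, d) \<in> D" "(d, e) \<in> D" "(a, e) \<in> D"
  shows classified
proof -
  have "b \<noteq> e" using no_triangle[of b c d] assms by (auto simp: in_symcl_iff)
  moreover have "a \<noteq> d" using no_triangle[of a b c] assms by (auto simp: in_symcl_iff)
  ultimately have ae: "sib (a, e) = (a, b)" "cosib (a, e) = (d, e)"
    using assms by (auto intro: sib_eq cosib_eq)
  define Q where "Q x f \<longleftrightarrow> fst f = snd (sib x) \<and> (snd f, fst (cosib x)) \<in> D" for x f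
  obtain \<beta> where \<beta>: "equivariant \<beta>" and Q\<beta>: "\<And>x. x \<in> D \<Longrightarrow> Q x (\<beta> x)"
  proof (rule equivariant_choice[of Q "(a, e)" "(b, c)"])
    show "Q (a, e) (b, c)" using ae assms by (simp add: Q_def)
  next
    fix g x f assume g: "g \<in> G" "x \<in> D" "f \<in> D" "Q x f"
    then show "Q (map_prod g g x) (map_prod g g f)"
      using equivariantD(2)[OF equivariant_sib g(2,1)] equivariantD(2)[OF equivariant_cosib g(2,1)]
      by (cases f; cases "sib x"; cases "cosib x") (auto simp: Q_def G_arc)
  next
    fix x f f' assume x: "x \<in> D" "f \<in> D" "f' \<in> D" "Q x f" "Q x f'"
    have "snd (sib x) \<noteq> fst (cosib x)"
      using no_triangle[of "fst x" "fst (cosib x)" "snd x"] sib_simps[OF x(1)] cosib_simps[OF x(1)] x(1)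
      by (metis in_symcl_iff prod.collapse)
    moreover have "(snd (sib x), snd f) \<in> D" "(snd (sib x), snd f') \<in> D"
      using x by (auto simp: Q_def) (metis prod.collapse)+
    ultimately have "snd f = snd f'"
      using no_square[of "snd (sib x)" "snd f" "fst (cosib x)" "snd f'"] x(4,5)
      by (auto simp: in_symcl_iff Q_def)
    then show "f = f'" using x(4,5) by (simp add: Q_def prod_eq_iff)
  qed (use assms in auto)
  define \<gamma> where "\<gamma> x = (snd (\<beta> x), fst (cosib x))" for x
  have \<gamma>: "equivariant \<gamma>"
    unfolding equivariant_def
  proof (intro ballI conjI)
    fix x g assume x: "x \<in> D" and g: "g \<in> G"
    show "\<gamma> (map_prod g g x) = map_prod g g (\<gamma> x)"
      using equivariantD(2)[OF \<beta> x g] equivariantD(2)[OF equivariant_cosib x g]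
      by (simp add: \<gamma>_def)
  qed (use Q\<beta> in \<open>simp add: Q_def \<gamma>_def\<close>)
  define f where "f x = \<gamma> (the_inv_into D \<beta> x)" for x
  have inj: "inj_on \<beta> D" and im: "\<beta> ` D = D"
    using equivariant_bij[OF \<beta>] by (auto simp: bij_betw_def)
  have f: "equivariant f"
    unfolding f_def by (rule equivariant_comp[OF \<gamma> equivariant_inv[OF \<beta>]])
  have "fst (f x) = snd x" if "x \<in> D" for x
    using f_the_inv_into_f[OF inj] that im by (simp add: f_def \<gamma>_def)
  then obtain m M where suc: "orientation_with_successor V D G m M" "\<And>e. e \<in> D \<Longrightarrow> m e = f e"
    using obtain_successor[OF f] by blast
  interpret orientation_with_successor V D G m M by (rule suc)
  have "fst (\<beta> (a, e)) = b" "(snd (\<beta> (a, e)), d) \<in> D" "\<beta> (a, e) \<in> D"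
    using Q\<beta>[of "(a, e)"] equivariantD(1)[OF \<beta>, of "(a, e)"] assms ae by (auto simp: Q_def)
  \<comment> \<open>\<open>\<beta>\<close> is known only through \<open>Q\<close>, so its value ends
    at some \<open>c'\<close>, which takes over the part of \<open>c\<close>.\<close>
  then obtain c' where c': "\<beta> (a, e) = (b, c')" "(b, c') \<in> D" "(c', d) \<in> D"
    by (metis prod.collapse)
  moreover have "m (b, c') = (c', d)"
    using suc(2)[OF c'(2)] the_inv_into_f_f[OF inj assms(5)] c'(1) ae by (simp add: f_def \<gamma>_def)
  ultimately show classified
    using relation_41[of "(a, e)" c'] assms ae by simp
qed

text \<open>
  If both continuations of an arc completed the pattern, then so would all \<open>2\<close>-paths, and the
  four vertices \<open>t, b, t', b'\<close> below would form a \<open>4\<close>-cycle.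
\<close>

lemma classified_if_pattern_32:
  assumes "(u, a) \<in> D" "(a, b) \<in> D" "(b, v) \<in> D" "(u, c) \<in> D" "(c, v) \<in> D"
  shows classified
proof -
  define Q where "Q e f \<longleftrightarrow> fst f = snd e \<and> (snd (sib e), fst (cosib f)) \<in> D" for e f
  have "c \<noteq> a" using no_triangle[of a b v] assms by (auto simp: in_symcl_iff)
  moreover have "b \<noteq> c" using no_triangle[of u a b] assms by (auto simp: in_symcl_iff)
  ultimately have "sib (u, c) = (u, a)" "cosib (c, v) = (b, v)"
    using assms by (auto intro: sib_eq cosib_eq)
  then have Q0: "Q (u, c) (c, v)" using assms by (simp add: Q_def)
  have Q_inv: "Q (map_prod g g e) (map_prod g g f)"
    if "g \<in> G" "e \<in> D" "f \<in> D" "Q e f" for g e f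
    using that equivariantD(2)[OF equivariant_sib that(2,1)] equivariantD(2)[OF equivariant_cosib that(3,1)]
    by (cases "sib e"; cases "cosib f") (auto simp: Q_def G_arc)
  have not_both: "\<not> Q e (sib f)" if e: "e \<in> D" and f: "f \<in> D" and Q: "Q e f" for e f
  proof
    assume Q': "Q e (sib f)"
    \<comment> \<open>The element of \<open>G\<close> that takes \<open>e\<close> to
      \<open>(x, y)\<close> takes \<open>f\<close> and \<open>sib f\<close> to the two arcs leaving
      \<open>y\<close>, one of which is \<open>(y, z)\<close>.\<close>
    have all: "(snd (sib (x, y)), fst (cosib (y, z))) \<in> D" if xy: "(x, y) \<in> D" and yz: "(y, z) \<in> D" for x y z
    proof -
      obtain g where g: "g \<in> G" "map_prod g g e = (x, y)"
        using e xy by (rule G_transitive')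
      have *: "Q (x, y) (map_prod g g f)" "Q (x, y) (sib (map_prod g g f))"
        using Q_inv[OF g(1) e f Q] Q_inv[OF g(1) e sib_simps(1)[OF f] Q'] g(2)
          equivariantD(2)[OF equivariant_sib f g(1)] by simp_all
      then have "(y, z) = map_prod g g f \<or> (y, z) = sib (map_prod g g f)"
        using same_tail[OF G_arc'[OF g(1) f] yz] by (simp add: Q_def)
      then show ?thesis using * by (auto simp: Q_def)
    qed
    obtain x y where xy: "e = (x, y)" by (cases e)
    obtain a where a: "sib (x, y) = (x, a)" "(x, a) \<in> D" "a \<noteq> y" "sib (x, a) = (x, y)"
      using sibE[OF e] xy by (metis fst_conv snd_conv)
    obtain t t' where t: "(y, t) \<in> D" "(y, t') \<in> D" "t \<noteq> t'"
      using f Q sib_simps[OF f] unfolding Q_def xy by (metis prod.collapse snd_conv)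
    obtain b where b: "cosib (y, t) = (b, t)" "(b, t) \<in> D" "b \<noteq> y"
      using cosibE[OF t(1)] by auto
    obtain b' where b': "cosib (y, t') = (b', t')" "(b', t') \<in> D" "b' \<noteq> y"
      using cosibE[OF t(2)] by auto
    have ab: "(a, b) \<in> D" "(a, b') \<in> D"
      using all[of x y t] all[of x y t'] t e xy a b b' by auto
    \<comment> \<open>Since \<open>sib (x, a)\<close> ends at \<open>y\<close>, the second
      in-neighbours of \<open>b\<close> and of \<open>b'\<close> are out-neighbours of
      \<open>y\<close>, hence \<open>t\<close> or \<open>t'\<close>; asymmetry decides
      which.\<close>
    have "(y, fst (cosib (a, b))) \<in> D" "(y, fst (cosib (a, b'))) \<in> D"
      using all[of x a b] all[of x a b'] ab a by auto
    moreover have "(fst (cosib (a, b)), b) \<in> D" "(fst (cosib (a, b')), b') \<in> D"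
      using cosib_simps(1,2)[OF ab(1)] cosib_simps(1,2)[OF ab(2)] by (metis prod.collapse snd_conv)+
    moreover have "w = t \<or> w = t'" if "(y, w) \<in> D" for w
      using ex1_sib[OF t(1)] t that by blast
    ultimately have "(t', b) \<in> D" "(t, b') \<in> D"
      using asym b(2) b'(2) by metis+
    then show False
      using no_square[of t b t' b'] b b' t ab(1) asym no_square[of y t b t']
      by (auto simp: in_symcl_iff)
  qed
  obtain f where f: "equivariant f" and Qf: "\<And>e. e \<in> D \<Longrightarrow> Q e (f e)"
  proof (rule equivariant_choice[of Q "(u, c)" "(c, v)"])
    fix e f f' assume "e \<in> D" "f \<in> D" "f' \<in> D" "Q e f" "Q e f'"
    then show "f = f'"
      using not_both[of e f] same_tail[of f f'] by (auto simp: Q_def)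
  qed (use assms Q0 Q_inv in auto)
  obtain m M where suc: "orientation_with_successor V D G m M" "\<And>e. e \<in> D \<Longrightarrow> m e = f e"
    using obtain_successor[OF f] Qf unfolding Q_def by blast
  interpret orientation_with_successor V D G m M by (rule suc)
  show classified
    using relation_32[OF assms(4)] Qf[OF assms(4)] suc(2)[OF assms(4)] by (simp add: Q_def)
qed

text \<open>Going round the pentagon, \<open>sib\<close> and \<open>cosib\<close> alternately lead
  from \<open>(v\<^sub>0, v\<^sub>1)\<close> through the three segments of length 1 to
  \<open>(v\<^sub>1, v\<^sub>2)\<close>. The successor map is thus a word in the two involutions,
  and no choice has to be made.\<close>

lemma no_pattern_2111:
  assumes "(v\<^sub>0, v\<^sub>1) \<in> D" "(v\<^sub>1, v\<^sub>2) \<in> D" "(v\<^sub>3, v\<^sub>2) \<in> D" "(v\<^sub>3, v\<^sub>4) \<in> D" "(v\<^sub>0, v\<^sub>4) \<in> D"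
  shows False
proof -
  define f where "f e = cosib (sib (cosib (sib e)))" for e
  have f: "equivariant f"
    using equivariant_comp[OF equivariant_comp[OF equivariant_cosib equivariant_sib]
        equivariant_comp[OF equivariant_cosib equivariant_sib]]
    unfolding f_def by simp
  have "v\<^sub>1 \<noteq> v\<^sub>4" using no_triangle[of v\<^sub>1 v\<^sub>2 v\<^sub>3] assms by (auto simp: in_symcl_iff)
  moreover have "v\<^sub>0 \<noteq> v\<^sub>3" using no_triangle[of v\<^sub>0 v\<^sub>1 v\<^sub>2] assms by (auto simp: in_symcl_iff)
  moreover have "v\<^sub>2 \<noteq> v\<^sub>4" using no_triangle[of v\<^sub>0 v\<^sub>1 v\<^sub>2] assms by (auto simp: in_symcl_iff)
  moreover have "v\<^sub>1 \<noteq> v\<^sub>3" using no_triangle[of v\<^sub>0 v\<^sub>1 v\<^sub>4] assms by (auto simp: in_symcl_iff)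
  ultimately have "sib (v\<^sub>0, v\<^sub>1) = (v\<^sub>0, v\<^sub>4)" "cosib (v\<^sub>0, v\<^sub>4) = (v\<^sub>3, v\<^sub>4)"
    "sib (v\<^sub>3, v\<^sub>4) = (v\<^sub>3, v\<^sub>2)" "cosib (v\<^sub>3, v\<^sub>2) = (v\<^sub>1, v\<^sub>2)"
    using assms by (simp_all add: sib_eq cosib_eq)
  then have f01: "f (v\<^sub>0, v\<^sub>1) = (v\<^sub>1, v\<^sub>2)" by (simp add: f_def)
  have "fst (f e) = snd e" if e: "e \<in> D" for e
  proof -
    obtain g where g: "g \<in> G" "map_prod g g (v\<^sub>0, v\<^sub>1) = e"
      using assms(1) e by (rule G_transitive')
    then show ?thesis using equivariantD(2)[OF f assms(1) g(1)] f01 by auto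
  qed
  then obtain m M where suc: "orientation_with_successor V D G m M" "\<And>e. e \<in> D \<Longrightarrow> m e = f e"
    using obtain_successor[OF f] by blast
  interpret orientation_with_successor V D G m M by (rule suc)
  show False
    using relation_2111[OF assms(1)] suc(2)[OF assms(1)] by (simp add: f_def)
qed

end

context arc_transitive_orientation
begin

text \<open>With a source at \<open>v\<^sub>0\<close> the directions of three edges remain open. Up
  to rotation and reflection, cases 1 and 8 have segments of lengths 4 and 1, cases 2 and 4 of
  lengths 3 and 2, and the other four of lengths 2, 1, 1 and 1.\<close>

lemma classified_if_pentagon_with_source:
  assumes s: "(v\<^sub>0, v\<^sub>1) \<in> D" "(v\<^sub>0, v\<^sub>4) \<in> D"
    and e: "(v\<^sub>1, v\<^sub>2) \<in> D\<^sup>s" "(v\<^sub>2, v\<^sub>3) \<in> D\<^sup>s" "(v\<^sub>3, v\<^sub>4) \<in> D\<^sup>s"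
  shows classified
proof -
  consider "(v\<^sub>1, v\<^sub>2) \<in> D" "(v\<^sub>2, v\<^sub>3) \<in> D" "(v\<^sub>3, v\<^sub>4) \<in> D"
    | "(v\<^sub>1, v\<^sub>2) \<in> D" "(v\<^sub>2, v\<^sub>3) \<in> D" "(v\<^sub>4, v\<^sub>3) \<in> D"
    | "(v\<^sub>1, v\<^sub>2) \<in> D" "(v\<^sub>3, v\<^sub>2) \<in> D" "(v\<^sub>3, v\<^sub>4) \<in> D"
    | "(v\<^sub>1, v\<^sub>2) \<in> D" "(v\<^sub>3, v\<^sub>2) \<in> D" "(v\<^sub>4, v\<^sub>3) \<in> D"
    | "(v\<^sub>2, v\<^sub>1) \<in> D" "(v\<^sub>2, v\<^sub>3) \<in> D" "(v\<^sub>3, v\<^sub>4) \<in> D"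
    | "(v\<^sub>2, v\<^sub>1) \<in> D" "(v\<^sub>2, v\<^sub>3) \<in> D" "(v\<^sub>4, v\<^sub>3) \<in> D"
    | "(v\<^sub>2, v\<^sub>1) \<in> D" "(v\<^sub>3, v\<^sub>2) \<in> D" "(v\<^sub>3, v\<^sub>4) \<in> D"
    | "(v\<^sub>2, v\<^sub>1) \<in> D" "(v\<^sub>3, v\<^sub>2) \<in> D" "(v\<^sub>4, v\<^sub>3) \<in> D"
    using e unfolding in_symcl_iff by blast
  then show ?thesis
  proof cases
    case 1
    then show ?thesis using classified_if_pattern_41[OF s(1) 1(1,2,3) s(2)] by blast
  next
    case 2
    then show ?thesis using classified_if_pattern_32[OF s(1) 2(1,2) s(2) 2(3)] by blast
  next
    case 3
    then show ?thesis using no_pattern_2111[OF s(1) 3(1,2,3) s(2)] by blast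
  next
    case 4
    then show ?thesis using classified_if_pattern_32[OF s(2) 4(3,2) s(1) 4(1)] by blast
  next
    case 5
    then show ?thesis using no_pattern_2111[OF 5(2,3) s(2,1) 5(1)] by blast
  next
    case 6
    then show ?thesis using no_pattern_2111[OF s(2) 6(3,2,1) s(1)] by blast
  next
    case 7
    then show ?thesis using no_pattern_2111[OF 7(2,1) s(1,2) 7(3)] by blast
  next
    case 8
    then show ?thesis using classified_if_pattern_41[OF s(2) 8(3,2,1) s(1)] by blast
  qed
qed

text \<open>A pentagon that is directed in neither sense has a vertex from which both of its edges
  leave; a rotation moves this vertex to the front.\<close>

lemma classified_if_undirected_pentagon:
  assumes e: "(v\<^sub>0, v\<^sub>1) \<in> D\<^sup>s" "(v\<^sub>1, v\<^sub>2) \<in> D\<^sup>s" "(v\<^sub>2, v\<^sub>3) \<in> D\<^sup>s" "(v\<^sub>3, v\<^sub>4) \<in> D\<^sup>s" "(v\<^sub>4, v\<^sub>0) \<in> D\<^sup>s"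
    and not_forward: "\<not> {(v\<^sub>0, v\<^sub>1), (v\<^sub>1, v\<^sub>2), (v\<^sub>2, v\<^sub>3), (v\<^sub>3, v\<^sub>4), (v\<^sub>4, v\<^sub>0)} \<subseteq> D"
    and not_backward: "\<not> {(v\<^sub>1, v\<^sub>0), (v\<^sub>2, v\<^sub>1), (v\<^sub>3, v\<^sub>2), (v\<^sub>4, v\<^sub>3), (v\<^sub>0, v\<^sub>4)} \<subseteq> D"
  shows classified
proof -
  consider "(v\<^sub>0, v\<^sub>1) \<in> D" "(v\<^sub>0, v\<^sub>4) \<in> D" | "(v\<^sub>1, v\<^sub>2) \<in> D" "(v\<^sub>1, v\<^sub>0) \<in> D"
    | "(v\<^sub>2, v\<^sub>3) \<in> D" "(v\<^sub>2, v\<^sub>1) \<in> D" | "(v\<^sub>3, v\<^sub>4) \<in> D" "(v\<^sub>3, v\<^sub>2) \<in> D"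
    | "(v\<^sub>4, v\<^sub>0) \<in> D" "(v\<^sub>4, v\<^sub>3) \<in> D"
    using assms unfolding in_symcl_iff insert_subset by blast
  then show ?thesis
  proof cases
    case 1 from classified_if_pentagon_with_source[OF this e(2,3,4)] show ?thesis .
  next
    case 2 from classified_if_pentagon_with_source[OF this e(3,4,5)] show ?thesis .
  next
    case 3 from classified_if_pentagon_with_source[OF this e(4,5,1)] show ?thesis .
  next
    case 4 from classified_if_pentagon_with_source[OF this e(5,1,2)] show ?thesis .
  next
    case 5 from classified_if_pentagon_with_source[OF this e(1,2,3)] show ?thesis .
  qed
qed

end

section \<open>Cycles, girth and induced orientations\<close>

lemma ucycle_iff:
  "ucycle \<Gamma> p \<longleftrightarrow>
     (\<exists>u. u \<in> pverts \<Gamma> \<and> set p \<subseteq> parcs \<Gamma> \<and> pcas u p u \<and> distinct (tl (pawalk_verts u p))) \<and>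
     3 \<le> length p"
  unfolding ucycle_def pre_digraph.cycle_def pre_digraph.awalk_def
    cas_with_proj_eq awalk_verts_with_proj_eq with_proj_simps
  by (cases p) simp_all

lemma girth_le: "ucycle \<Gamma> p \<Longrightarrow> girth \<Gamma> \<le> length p"
  unfolding girth_def by (rule INF_lower) simp

lemma (in pair_graph) sym_arc: "(u, v) \<in> parcs G \<Longrightarrow> (v, u) \<in> parcs G"
  using pair_sym_arcs[unfolded symmetric_def with_proj_simps] by (rule symD)

lemma (in pair_graph) no_triangle_if_girth:
  assumes "4 \<le> girth G" "(a, b) \<in> parcs G" "(b, c) \<in> parcs G"
  shows "(c, a) \<notin> parcs G"
proof
  assume "(c, a) \<in> parcs G"
  then have "ucycle G [(a, b), (b, c), (c, a)]"
    using assms(2,3) by (auto simp: ucycle_iff in_arcsD1 dest: no_loops')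
  then show False using girth_le assms(1) order_trans by fastforce
qed

lemma (in pair_graph) no_square_if_girth:
  assumes "5 \<le> girth G" "(a, b) \<in> parcs G" "(b, c) \<in> parcs G" "(c, d) \<in> parcs G" "(d, a) \<in> parcs G"
  shows "a = c \<or> b = d"
proof (rule ccontr)
  assume "\<not> (a = c \<or> b = d)"
  then have "ucycle G [(a, b), (b, c), (c, d), (d, a)]"
    using assms(2-5) by (auto simp: ucycle_iff in_arcsD1 dest: no_loops')
  then show False using girth_le assms(1) order_trans by fastforce
qed

text \<open>Connectedness is defined through the symmetric closure, which for a graph has the same
  reachability as the graph itself.\<close>

lemma connected_closed_subset:
  assumes "pair_graph \<Gamma>" "Digraph_Component.connected (with_proj \<Gamma>)"
    and U: "U \<subseteq> pverts \<Gamma>" "U \<noteq> {}" "\<And>u v. (u, v) \<in> parcs \<Gamma> \<Longrightarrow> u \<in> U \<Longrightarrow> v \<in> U"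
  shows "U = pverts \<Gamma>"
proof -
  interpret pair_graph \<Gamma> by fact
  obtain u where u: "u \<in> U" using U(2) by auto
  have "v \<in> U" if "v \<in> pverts \<Gamma>" for v
  proof -
    have "u \<rightarrow>\<^sup>*\<^bsub>with_proj (mk_symmetric (with_proj \<Gamma>))\<^esub> v"
      using assms(2) subsetD[OF U(1) u] that
      unfolding Digraph_Component.connected_def strongly_connected_def by simp
    then have "(u, v) \<in> (parcs \<Gamma>)\<^sup>*"
      using reachable_mk_symmetric_eq[OF pair_sym_arcs] reachable_rtranclI by fastforce
    then show ?thesis using u U(3) by (induction rule: rtrancl_induct) auto
  qed
  then show ?thesis using U(1) by auto
qed

text \<open>Edge-transitivity makes the orbit \<open>D\<close> meet every edge. If \<open>D\<close>
  contained both directions of one edge, it would by transitivity be symmetric, hence contain all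
  arcs, and \<open>G\<close> would be arc-transitive. By vertex-transitivity the out-degree and the
  in-degree are constant; they are equal and add up to 4.\<close>

lemma half_arc_transitive_orientation:
  fixes \<Gamma> :: "'a pair_pre_digraph"
  assumes \<Gamma>: "pair_graph \<Gamma>" "Digraph_Component.connected (with_proj \<Gamma>)" "tetravalent \<Gamma>" "girth \<Gamma> = 5"
    and hat: "half_arc_transitive \<Gamma> G" and D: "induced_orientation \<Gamma> G D"
  shows "arc_transitive_orientation (pverts \<Gamma>) D G" "D\<^sup>s = parcs \<Gamma>"
proof -
  interpret pair_graph \<Gamma> by fact
  note hat' = hat[unfolded half_arc_transitive_iff[OF \<Gamma>(1)]]
  note sub_G = hat'[THEN conjunct1]
    and vertex_trans = hat'[THEN conjunct2, THEN conjunct1, rule_format]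
    and edge_trans = hat'[THEN conjunct2, THEN conjunct2, THEN conjunct1, rule_format]
    and not_arc_trans = hat'[THEN conjunct2, THEN conjunct2, THEN conjunct2]
  have auts: "g \<in> graph_auts \<Gamma>" if "g \<in> G" for g
    using subgroup.subset[OF sub_G] that by (auto simp: Aut_def)
  obtain x y where xy: "(x, y) \<in> parcs \<Gamma>" and D_orb: "D = {(g x, g y) | g. g \<in> G}"
    using D by (auto simp: induced_orientation_def orbits_def orbit_def arc_action_def)
  interpret A: group_action "Aut \<Gamma>\<lparr>carrier := G\<rparr>" "parcs \<Gamma>" "arc_action \<Gamma>"
    using group_action_arcs[OF \<Gamma>(1) sub_G] .
  have D_orbit: "D = orbit (Aut \<Gamma>\<lparr>carrier := G\<rparr>) (arc_action \<Gamma>) (x, y)"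
    unfolding D_orb orbit_def using xy by (auto simp: arc_action_def)
  have G_arcs: "(g u, g v) \<in> parcs \<Gamma>" if "g \<in> G" "(u, v) \<in> parcs \<Gamma>" for g u v
    using graph_autsD(3)[OF auts[OF that(1)] in_arcsD1[OF that(2)] in_arcsD2[OF that(2)]] that(2) by simp
  have sub: "D \<subseteq> parcs \<Gamma>"
    using G_arcs xy unfolding D_orb by auto
  have trans: "\<exists>g\<in>G. g u = u' \<and> g v = v'" if uv: "(u, v) \<in> D" "(u', v') \<in> D" for u v u' v'
  proof -
    have P: "(u, v) \<in> parcs \<Gamma>" "(u', v') \<in> parcs \<Gamma>"
      using uv sub by auto
    have "(u', v') \<in> orbit (Aut \<Gamma>\<lparr>carrier := G\<rparr>) (arc_action \<Gamma>) (u, v)"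
      using A.orbit_trans[OF P(1) xy P(2)] A.orbit_sym[OF xy P(1)] uv unfolding D_orbit by simp
    then show ?thesis using P(1) by (auto simp: orbit_def arc_action_def)
  qed
  have arc: "(g u, g v) \<in> D" if g: "g \<in> G" and uv: "(u, v) \<in> D" for g u v
  proof -
    have P: "(u, v) \<in> parcs \<Gamma>" using uv sub by blast
    then have "(g u, g v) \<in> orbit (Aut \<Gamma>\<lparr>carrier := G\<rparr>) (arc_action \<Gamma>) (u, v)"
      using g by (auto simp: orbit_def arc_action_def)
    then show ?thesis
      using A.orbit_trans[OF xy P G_arcs[OF g P]] uv unfolding D_orbit by simp
  qed
  show Ds: "D\<^sup>s = parcs \<Gamma>"
  proof (intro equalityI subrelI)
    fix u v assume uv: "(u, v) \<in> parcs \<Gamma>"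
    then have "{x, y} \<in> uedges \<Gamma>" "{u, v} \<in> uedges \<Gamma>"
      using xy by (force simp: uedges_def)+
    then obtain g where "g \<in> G" "g ` {x, y} = {u, v}" using edge_trans by blast
    then show "(u, v) \<in> D\<^sup>s"
      unfolding D_orb in_symcl_iff by (auto simp: doubleton_eq_iff)
  qed (use sub sym_arc in \<open>auto simp: in_symcl_iff\<close>)
  have asym: "(v, u) \<notin> D" if uv: "(u, v) \<in> D" for u v
  proof
    assume vu: "(v, u) \<in> D"
    have "(v', u') \<in> D" if u'v': "(u', v') \<in> D" for u' v'
    proof -
      obtain g where "g \<in> G" "g u = u'" "g v = v'" using trans[OF uv u'v'] by blast
      then show ?thesis using arc[OF _ vu] by blast
    qed
    then have "D\<^sup>s = D" by (auto simp: in_symcl_iff)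
    then have "D = parcs \<Gamma>" using Ds by simp
    then show False using not_arc_trans trans by auto
  qed
  have finD: "finite D" using sub pair_finite_arcs finite_subset by blast
  have DV: "D \<subseteq> pverts \<Gamma> \<times> pverts \<Gamma>"
    using subsetD[OF sub] by (auto dest: in_arcsD1 in_arcsD2)
  have inj: "inj_on g (pverts \<Gamma>)" if "g \<in> G" for g
    using graph_autsD(1)[OF auts[OF that]] by (simp add: bij_betw_def)
  have degree_le: "card (R `` {u}) \<le> card (R `` {v})"
    if u: "u \<in> pverts \<Gamma>" and v: "v \<in> pverts \<Gamma>" and R: "R = D \<or> R = D\<inverse>" for u v R
  proof -
    obtain g where g: "g \<in> G" "g u = v" using vertex_trans[OF u v] by blast
    show ?thesis
    proof (rule card_inj_on_le)
      show "inj_on g (R `` {u})" using R DV by (auto intro!: inj_on_subset[OF inj[OF g(1)]])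
      show "g ` (R `` {u}) \<subseteq> R `` {v}" using R arc[OF g(1)] g(2) by auto
      show "finite (R `` {v})" using R finD by (auto intro: finite_Image)
    qed
  qed
  define d\<^sub>o where "d\<^sub>o = card (D `` {x})"
  define d\<^sub>i where "d\<^sub>i = card (D\<inverse> `` {x})"
  have x: "x \<in> pverts \<Gamma>" using xy in_arcsD1 by blast
  have outs: "card (D `` {v}) = d\<^sub>o" and ins: "card (D\<inverse> `` {v}) = d\<^sub>i" if "v \<in> pverts \<Gamma>" for v
    using degree_le[OF x that] degree_le[OF that x] unfolding d\<^sub>o_def d\<^sub>i_def
    by (auto intro: antisym)
  have "D = Sigma (pverts \<Gamma>) (\<lambda>v. D `` {v})" "D\<inverse> = Sigma (pverts \<Gamma>) (\<lambda>v. D\<inverse> `` {v})"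
    using DV by auto
  then have "card D = (\<Sum>v\<in>pverts \<Gamma>. card (D `` {v}))" "card (D\<inverse>) = (\<Sum>v\<in>pverts \<Gamma>. card (D\<inverse> `` {v}))"
    using card_SigmaI[of "pverts \<Gamma>" "\<lambda>v. D `` {v}"] card_SigmaI[of "pverts \<Gamma>" "\<lambda>v. D\<inverse> `` {v}"]
      pair_finite_verts finD by (metis finite_Image finite_converse)+
  \<comment> \<open>Counting \<open>D\<close> by tails and by heads shows that the two degrees
    agree.\<close>
  then have "card (pverts \<Gamma>) * d\<^sub>o = card (pverts \<Gamma>) * d\<^sub>i"
    using outs ins by simp
  then have "d\<^sub>o = d\<^sub>i" using x pair_finite_verts by (auto simp: card_gt_0_iff)
  moreover have "d\<^sub>o + d\<^sub>i = 4"
  proof -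
    have "{e \<in> parcs \<Gamma>. fst e = x} = Pair x ` (D `` {x} \<union> D\<inverse> `` {x})"
      unfolding Ds[symmetric] by (auto simp: in_symcl_iff image_iff)
    then have "out_degree (with_proj \<Gamma>) x = card (D `` {x} \<union> D\<inverse> `` {x})"
      by (simp add: out_degree_def out_arcs_def card_image inj_on_def)
    also have "\<dots> = d\<^sub>o + d\<^sub>i"
      unfolding d\<^sub>o_def d\<^sub>i_def using finD asym by (intro card_Un_disjoint) (auto intro: finite_Image)
    finally show ?thesis using \<Gamma>(3) x by (simp add: tetravalent_def)
  qed
  ultimately have two: "d\<^sub>o = 2" "d\<^sub>i = 2" by simp_all
  show "arc_transitive_orientation (pverts \<Gamma>) D G"
  proof
    show "finite (pverts \<Gamma>)" by (rule pair_finite_verts)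
    show "D \<subseteq> pverts \<Gamma> \<times> pverts \<Gamma>" by (rule DV)
    show "D \<noteq> {}" using two(1) by (auto simp: d\<^sub>o_def)
    show "inj_on g (pverts \<Gamma>)" if "g \<in> G" for g using inj that .
    show "(g u, g v) \<in> D" if "g \<in> G" "(u, v) \<in> D" for g u v using arc that .
    show "\<exists>g\<in>G. g u = u' \<and> g v = v'" if "(u, v) \<in> D" "(u', v') \<in> D" for u v u' v' using trans that .
    show "card (D `` {v}) = 2" if "v \<in> pverts \<Gamma>" for v using outs that two by simp
    show "card (D\<inverse> `` {v}) = 2" if "v \<in> pverts \<Gamma>" for v using ins that two by simp
    show "(v, u) \<notin> D" if "(u, v) \<in> D" for u v using asym that .
    show "(c, a) \<notin> D\<^sup>s" if "(a, b) \<in> D\<^sup>s" "(b, c) \<in> D\<^sup>s" for a b c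
      using no_triangle_if_girth[of a b c] \<Gamma>(4) that unfolding Ds by simp
    show "a = c \<or> b = d" if "(a, b) \<in> D\<^sup>s" "(b, c) \<in> D\<^sup>s" "(c, d) \<in> D\<^sup>s" "(d, a) \<in> D\<^sup>s" for a b c d
      using no_square_if_girth[of a b c d] \<Gamma>(4) that unfolding Ds by simp
    show "U = pverts \<Gamma>"
      if "U \<subseteq> pverts \<Gamma>" "U \<noteq> {}" "\<And>u v. (u, v) \<in> D \<Longrightarrow> u \<in> U \<longleftrightarrow> v \<in> U" for U
    proof (rule connected_closed_subset[OF \<Gamma>(1,2) that(1,2)])
      show "v \<in> U" if "(u, v) \<in> parcs \<Gamma>" "u \<in> U" for u v
        using that \<open>\<And>u v. (u, v) \<in> D \<Longrightarrow> u \<in> U \<longleftrightarrow> v \<in> U\<close>[of u v]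
          \<open>\<And>u v. (u, v) \<in> D \<Longrightarrow> u \<in> U \<longleftrightarrow> v \<in> U\<close>[of v u]
        unfolding Ds[symmetric] in_symcl_iff by blast
    qed
  qed
qed

lemma pentagon_if_ucycle:
  assumes "ucycle \<Gamma> p" "length p = 5"
  obtains v\<^sub>0 v\<^sub>1 v\<^sub>2 v\<^sub>3 v\<^sub>4 where "p = [(v\<^sub>0, v\<^sub>1), (v\<^sub>1, v\<^sub>2), (v\<^sub>2, v\<^sub>3), (v\<^sub>3, v\<^sub>4), (v\<^sub>4, v\<^sub>0)]"
    "set p \<subseteq> parcs \<Gamma>" "distinct [v\<^sub>0, v\<^sub>1, v\<^sub>2, v\<^sub>3, v\<^sub>4]"
proof -
  obtain a b c d e where "p = [a, b, c, d, e]"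
    using assms(2) by (auto simp: length_Suc_conv numeral_eq_Suc)
  then show ?thesis
    using assms(1) that by (cases a; cases b; cases c; cases d; cases e) (auto simp: ucycle_iff)
qed

lemma directed_cycleI:
  assumes "inj_on fst (oriented_arcs D p)" "inj_on snd (oriented_arcs D p)"
    and "fst ` set p \<subseteq> fst ` oriented_arcs D p" "fst ` set p \<subseteq> snd ` oriented_arcs D p"
  shows "directed_cycle D p"
  unfolding directed_cycle_def
proof (intro ballI conjI)
  fix v assume v: "v \<in> fst ` set p"
  show "\<exists>!a. a \<in> oriented_arcs D p \<and> snd a = v"
    using subsetD[OF assms(4) v] inj_onD[OF assms(2)] by auto
  show "\<exists>!a. a \<in> oriented_arcs D p \<and> fst a = v"
    using subsetD[OF assms(3) v] inj_onD[OF assms(1)] by auto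
qed

text \<open>If \<open>p\<close> or its reverse runs along \<open>D\<close>, asymmetry leaves no
  other arc of \<open>D\<close> on the edges of \<open>p\<close>. The contrapositive supplies the
  negated hypotheses of \<open>classified_if_undirected_pentagon\<close>.\<close>

lemma directed_pentagon:
  assumes p: "p = [(v\<^sub>0, v\<^sub>1), (v\<^sub>1, v\<^sub>2), (v\<^sub>2, v\<^sub>3), (v\<^sub>3, v\<^sub>4), (v\<^sub>4, v\<^sub>0)]"
    and dist: "distinct [v\<^sub>0, v\<^sub>1, v\<^sub>2, v\<^sub>3, v\<^sub>4]" and asym: "\<And>u v. (u, v) \<in> D \<Longrightarrow> (v, u) \<notin> D"
    and dir: "set p \<subseteq> D \<or> (set p)\<inverse> \<subseteq> D"
  shows "directed_cycle D p"
proof -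
  have "oriented_arcs D p = set p \<or> oriented_arcs D p = (set p)\<inverse>"
    using dir
  proof
    assume p_D: "set p \<subseteq> D"
    have "oriented_arcs D p = set p"
    proof (intro equalityI subrelI)
      fix u v assume "(u, v) \<in> oriented_arcs D p"
      then show "(u, v) \<in> set p"
        using asym[of u v] p_D unfolding oriented_arcs_def Int_iff in_symcl_iff by blast
    qed (use p_D in \<open>auto simp: oriented_arcs_def in_symcl_iff\<close>)
    then show ?thesis ..
  next
    assume p_D: "(set p)\<inverse> \<subseteq> D"
    have "oriented_arcs D p = (set p)\<inverse>"
    proof (intro equalityI subrelI)
      fix u v assume "(u, v) \<in> oriented_arcs D p"
      then show "(u, v) \<in> (set p)\<inverse>"
        using asym[of u v] p_D unfolding oriented_arcs_def Int_iff in_symcl_iff by blast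
    qed (use p_D in \<open>auto simp: oriented_arcs_def in_symcl_iff\<close>)
    then show ?thesis ..
  qed
  then show ?thesis
  proof
    assume O: "oriented_arcs D p = set p"
    show ?thesis
      by (rule directed_cycleI; unfold O; unfold p) (use dist in auto)
  next
    assume "oriented_arcs D p = (set p)\<inverse>"
    also have "\<dots> = set (map prod.swap p)" by force
    finally have O: "oriented_arcs D p = set (map prod.swap p)" .
    show ?thesis
      by (rule directed_cycleI; unfold O; unfold p) (use dist in auto)
  qed
qed

lemma classified_if_undirected:
  fixes \<Gamma> :: "'a pair_pre_digraph"
  assumes \<Gamma>: "pair_graph \<Gamma>" "Digraph_Component.connected (with_proj \<Gamma>)" "tetravalent \<Gamma>" "girth \<Gamma> = 5"
    and G: "half_arc_transitive \<Gamma> G" "induced_orientation \<Gamma> G D"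
    and p: "ucycle \<Gamma> p" "length p = 5" "\<not> directed_cycle D p"
  shows "coded_by holt_code (pverts \<Gamma>) (parcs \<Gamma>) \<or> coded_by rose41_code (pverts \<Gamma>) (parcs \<Gamma>) \<or>
    coded_by rose32_code (pverts \<Gamma>) (parcs \<Gamma>)"
proof -
  interpret arc_transitive_orientation "pverts \<Gamma>" D G
    by (rule half_arc_transitive_orientation(1)[OF \<Gamma> G])
  have Ds: "D\<^sup>s = parcs \<Gamma>" by (rule half_arc_transitive_orientation(2)[OF \<Gamma> G])
  obtain v\<^sub>0 v\<^sub>1 v\<^sub>2 v\<^sub>3 v\<^sub>4 where v: "p = [(v\<^sub>0, v\<^sub>1), (v\<^sub>1, v\<^sub>2), (v\<^sub>2, v\<^sub>3), (v\<^sub>3, v\<^sub>4), (v\<^sub>4, v\<^sub>0)]"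
    "set p \<subseteq> parcs \<Gamma>" "distinct [v\<^sub>0, v\<^sub>1, v\<^sub>2, v\<^sub>3, v\<^sub>4]"
    using pentagon_if_ucycle[OF p(1,2)] .
  have "\<not> set p \<subseteq> D" "\<not> (set p)\<inverse> \<subseteq> D"
    using directed_pentagon[OF v(1,3) asym] p(3) by auto
  then have classified
    using v(1,2) unfolding Ds[symmetric]
    by (intro classified_if_undirected_pentagon[of v\<^sub>0 v\<^sub>1 v\<^sub>2 v\<^sub>3 v\<^sub>4]) auto
  then show ?thesis unfolding classified_def Ds .
qed

section \<open>The two graphs\<close>

text \<open>Here \<open>graph_auts\<close> is applied to the orientation itself, a digraph; whatever
  preserves \<open>D\<close> and its complement also preserves the symmetric closure.\<close>

lemma subgroup_graph_auts_orientation: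
  assumes "D\<^sup>s = parcs \<Gamma>"
  shows "subgroup (graph_auts \<lparr>pverts = pverts \<Gamma>, parcs = D\<rparr>) (Aut \<Gamma>)"
proof -
  have "graph_auts \<lparr>pverts = pverts \<Gamma>, parcs = D\<rparr> \<subseteq> graph_auts \<Gamma>"
    unfolding graph_auts_def assms[symmetric] by (auto simp: in_symcl_iff)
  then show ?thesis
    using group.subgroup_incl[OF group_BijGroup _ subgroup_graph_auts[of \<Gamma>]]
      subgroup_graph_auts[of "\<lparr>pverts = pverts \<Gamma>, parcs = D\<rparr>"]
    by (simp add: Aut_def)
qed

text \<open>The group consists of all automorphisms of the orientation. It is enough to reach every
  arc from one base arc \<open>d\<close>, since one such map can be composed with the inverse of
  another. No element reverses an arc, because \<open>D\<close> is asymmetric.\<close>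

lemma half_arc_transitive_if_orientation:
  fixes \<Gamma> :: "'a pair_pre_digraph"
  assumes \<Gamma>: "pair_graph \<Gamma>" and Ds: "D\<^sup>s = parcs \<Gamma>"
    and asym: "\<And>u v. (u, v) \<in> D \<Longrightarrow> (v, u) \<notin> D"
    and tails: "fst ` D = pverts \<Gamma>" and d: "d \<in> D"
    and trans: "\<And>e. e \<in> D \<Longrightarrow>
      \<exists>f. bij_betw f (pverts \<Gamma>) (pverts \<Gamma>) \<and> map_prod f f ` D = D \<and> map_prod f f d = e"
  defines "G \<equiv> graph_auts \<lparr>pverts = pverts \<Gamma>, parcs = D\<rparr>"
  shows "half_arc_transitive \<Gamma> G" "induced_orientation \<Gamma> G D"
proof -
  interpret pair_graph \<Gamma> by fact
  have sub: "D \<subseteq> parcs \<Gamma>" unfolding Ds[symmetric] by (auto simp: in_symcl_iff)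
  have DV: "u \<in> pverts \<Gamma>" "v \<in> pverts \<Gamma>" if "(u, v) \<in> D" for u v
    using subsetD[OF sub that] in_arcsD1 in_arcsD2 by blast+
  have G_iff: "(g u, g v) \<in> D \<longleftrightarrow> (u, v) \<in> D"
    if "g \<in> G" "u \<in> pverts \<Gamma>" "v \<in> pverts \<Gamma>" for g u v
    using that unfolding G_def graph_auts_def by simp
  have arc_trans: "\<exists>g\<in>G. g u = u' \<and> g v = v'" if uv: "(u, v) \<in> D" and uv': "(u', v') \<in> D" for u v u' v'
  proof -
    have reflect: "(f a, f b) \<in> D \<longleftrightarrow> (a, b) \<in> D"
      if f: "bij_betw f (pverts \<Gamma>) (pverts \<Gamma>)" "map_prod f f ` D = D"
        and ab: "a \<in> pverts \<Gamma>" "b \<in> pverts \<Gamma>" for f a b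
    proof
      assume "(f a, f b) \<in> D"
      then have "(f a, f b) \<in> map_prod f f ` D" using f(2) by simp
      then obtain a' b' where ab': "(a', b') \<in> D" "f a = f a'" "f b = f b'" by auto
      then have "a = a'" "b = b'"
        using inj_onD[OF bij_betw_imp_inj_on[OF f(1)] _ ab(1)]
          inj_onD[OF bij_betw_imp_inj_on[OF f(1)] _ ab(2)] DV[OF ab'(1)] by auto
      then show "(a, b) \<in> D" using ab' by simp
    next
      assume "(a, b) \<in> D"
      then have "map_prod f f (a, b) \<in> map_prod f f ` D" by (rule imageI)
      then show "(f a, f b) \<in> D" using f(2) by simp
    qed
    obtain f where f: "bij_betw f (pverts \<Gamma>) (pverts \<Gamma>)" "map_prod f f ` D = D" "map_prod f f d = (u, v)"
      using trans[OF uv] by blast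
    obtain f' where f': "bij_betw f' (pverts \<Gamma>) (pverts \<Gamma>)" "map_prod f' f' ` D = D" "map_prod f' f' d = (u', v')"
      using trans[OF uv'] by blast
    define k where "k = inv_into (pverts \<Gamma>) f"
    have k: "bij_betw k (pverts \<Gamma>) (pverts \<Gamma>)" unfolding k_def by (rule bij_betw_inv_into[OF f(1)])
    have fk: "f (k a) = a" "k a \<in> pverts \<Gamma>" if "a \<in> pverts \<Gamma>" for a
      using that bij_betw_inv_into_right[OF f(1)] bij_betwE[OF k] by (auto simp: k_def)
    \<comment> \<open>The restriction is there because the members of \<open>graph_auts\<close> are
      extensional functions.\<close>
    define g where "g = restrict (f' \<circ> k) (pverts \<Gamma>)"
    have "bij_betw g (pverts \<Gamma>) (pverts \<Gamma>)"
      unfolding g_def using bij_betw_trans[OF k f'(1)] by simp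
    moreover have "(g a, g b) \<in> D \<longleftrightarrow> (a, b) \<in> D" if "a \<in> pverts \<Gamma>" "b \<in> pverts \<Gamma>" for a b
      using reflect[OF f'(1,2), of "k a" "k b"] reflect[OF f(1,2), of "k a" "k b"] fk that
      by (simp add: g_def)
    ultimately have "g \<in> G" by (simp add: G_def graph_auts_def Bij_def g_def)
    obtain x y where xy: "d = (x, y)" by (cases d)
    then have "x \<in> pverts \<Gamma>" "y \<in> pverts \<Gamma>" using DV d by auto
    then have "k u = x" "k v = y"
      using f(3) xy bij_betw_inv_into_left[OF f(1)] by (auto simp: k_def)
    then have "g u = u'" "g v = v'"
      using DV[OF uv] f'(3) xy by (auto simp: g_def)
    then show ?thesis using \<open>g \<in> G\<close> by blast
  qed
  have sub_G: "subgroup G (Aut \<Gamma>)"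
    unfolding G_def by (rule subgroup_graph_auts_orientation[OF Ds])
  have edge: "\<exists>u v. e = {u, v} \<and> (u, v) \<in> D" if "e \<in> uedges \<Gamma>" for e
  proof -
    obtain a b where ab: "e = {a, b}" "(a, b) \<in> D\<^sup>s" using \<open>e \<in> uedges \<Gamma>\<close> by (auto simp: uedges_def Ds)
    then show ?thesis unfolding in_symcl_iff by (metis insert_commute)
  qed
  show "half_arc_transitive \<Gamma> G"
    unfolding half_arc_transitive_iff[OF \<Gamma>]
  proof (intro conjI ballI sub_G)
    fix u v assume "u \<in> pverts \<Gamma>" "v \<in> pverts \<Gamma>"
    then obtain u' v' where "(u, u') \<in> D" "(v, v') \<in> D"
      unfolding tails[symmetric] by auto
    from arc_trans[OF this] show "\<exists>g\<in>G. g u = v" by blast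
  next
    fix e e' assume e: "e \<in> uedges \<Gamma>" and e': "e' \<in> uedges \<Gamma>"
    obtain u v u' v' where uv: "e = {u, v}" "(u, v) \<in> D" "e' = {u', v'}" "(u', v') \<in> D"
      using edge[OF e] edge[OF e'] by auto
    obtain g where "g \<in> G" "g u = u'" "g v = v'" using arc_trans[OF uv(2,4)] by blast
    then show "\<exists>g\<in>G. g ` e = e'" using uv by auto
  next
    obtain x y where xy: "(x, y) \<in> D" using d by (cases d) auto
    have flip: "\<not> (g x = y \<and> g y = x)" if "g \<in> G" for g
      using G_iff[OF that DV[OF xy]] xy asym[OF xy] by auto
    have arcs: "(x, y) \<in> parcs \<Gamma>" "(y, x) \<in> parcs \<Gamma>"
      unfolding Ds[symmetric] using xy by (auto simp: in_symcl_iff)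
    show "\<not> (\<forall>(u, v)\<in>parcs \<Gamma>. \<forall>(u', v')\<in>parcs \<Gamma>. \<exists>g\<in>G. g u = u' \<and> g v = v')"
    proof
      assume "\<forall>(u, v)\<in>parcs \<Gamma>. \<forall>(u', v')\<in>parcs \<Gamma>. \<exists>g\<in>G. g u = u' \<and> g v = v'"
      from bspec[OF this arcs(1), unfolded case_prod_conv]
      have "\<forall>(u', v')\<in>parcs \<Gamma>. \<exists>g\<in>G. g x = u' \<and> g y = v'" .
      from bspec[OF this arcs(2), unfolded case_prod_conv] show False using flip by blast
    qed
  qed
  obtain x y where xy: "(x, y) \<in> D" using d by (cases d) auto
  have "orbit (Aut \<Gamma>\<lparr>carrier := G\<rparr>) (arc_action \<Gamma>) (x, y) = {(g x, g y) | g. g \<in> G}"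
    using subsetD[OF sub xy] by (auto simp: orbit_def arc_action_def)
  also have "\<dots> = D"
  proof (intro equalityI subrelI)
    fix u v assume "(u, v) \<in> D"
    from arc_trans[OF xy this] show "(u, v) \<in> {(g x, g y) | g. g \<in> G}" by auto
  qed (use G_iff[OF _ DV[OF xy]] xy in auto)
  finally have "D = orbit (Aut \<Gamma>\<lparr>carrier := G\<rparr>) (arc_action \<Gamma>) (x, y)" ..
  then show "induced_orientation \<Gamma> G D"
    using subsetD[OF sub xy] unfolding induced_orientation_def orbits_def by blast
qed

text \<open>This turns a walk through all arcs, in which each step applies a known symmetry, into
  transitivity.\<close>

lemma successively_closed:
  "successively R xs \<Longrightarrow> xs \<noteq> [] \<Longrightarrow> hd xs \<in> S \<Longrightarrow> (\<And>x y. x \<in> S \<Longrightarrow> R x y \<Longrightarrow> y \<in> S) \<Longrightarrow> set xs \<subseteq> S"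
  by (induction R xs rule: successively.induct) auto

text \<open>The conditions are chosen for evaluation on concrete lists: surjectivity on vertices and
  inclusion on arcs. Finiteness upgrades them to bijections.\<close>

definition code_symmetry :: "nat \<Rightarrow> (nat \<times> nat) list \<Rightarrow> (nat \<Rightarrow> nat) \<Rightarrow> bool" where
  "code_symmetry n L p \<longleftrightarrow> p ` {..<n} = {..<n} \<and> (\<forall>d\<in>set L. map_prod p p d \<in> set L)"

text \<open>Each arc in \<open>L\<close> is the image of its predecessor under \<open>p\<close> or
  \<open>q\<close>, so compositions of these two symmetries reach every arc from
  \<open>hd L\<close>. The given pentagon has a source at \<open>v\<^sub>0\<close> and is therefore
  undirected.\<close>

lemma undirected_pentagon_if_coded:
  fixes \<Gamma> :: "'a pair_pre_digraph"
  assumes \<Gamma>: "pair_graph \<Gamma>" and coded: "coded_by c (pverts \<Gamma>) (parcs \<Gamma>)"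
    and L: "set L = code_arcs c" "\<forall>(i, j)\<in>set L. (j, i) \<notin> set L"
      "fst ` set L = {..<length c div 2}" "snd ` set L \<subseteq> {..<length c div 2}"
    and sym: "code_symmetry (length c div 2) L p" "code_symmetry (length c div 2) L q"
    and path: "successively (\<lambda>d d'. d' = map_prod p p d \<or> d' = map_prod q q d) L"
      "L \<noteq> []"
    and pattern: "{(v\<^sub>0, v\<^sub>1), (v\<^sub>1, v\<^sub>2), (v\<^sub>2, v\<^sub>3), (v\<^sub>3, v\<^sub>4), (v\<^sub>0, v\<^sub>4)} \<subseteq> set L"
      "distinct [v\<^sub>0, v\<^sub>1, v\<^sub>2, v\<^sub>3, v\<^sub>4]"
  shows "\<exists>G D p. half_arc_transitive \<Gamma> G \<and> induced_orientation \<Gamma> G D \<and>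
    ucycle \<Gamma> p \<and> length p = 5 \<and> \<not> directed_cycle D p"
proof -
  define I where "I = {..<length c div 2}"
  obtain h where h: "bij_betw h I (pverts \<Gamma>)" and E: "parcs \<Gamma> = map_prod h h ` (set L)\<^sup>s"
    using coded unfolding coded_by_def L(1) I_def by blast
  define D where "D = map_prod h h ` set L"
  have Ds: "D\<^sup>s = parcs \<Gamma>" unfolding D_def E map_prod_symcl ..
  have LI: "i \<in> I" "j \<in> I" if "(i, j) \<in> set L" for i j
    using that L(3,4) unfolding I_def by force+
  have h_eq: "h i = h j \<longleftrightarrow> i = j" if "i \<in> I" "j \<in> I" for i j
    using inj_on_eq_iff[OF bij_betw_imp_inj_on[OF h]] that .
  have hD: "(h i, h j) \<in> D \<longleftrightarrow> (i, j) \<in> set L" if "i \<in> I" "j \<in> I" for i j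
    using that h_eq LI unfolding D_def by (force simp: image_iff)
  define A where "A = {f. bij_betw f (pverts \<Gamma>) (pverts \<Gamma>) \<and> map_prod f f ` D = D}"
  define k where "k = inv_into I h"
  have kh: "k (h i) = i" if "i \<in> I" for i
    unfolding k_def using bij_betw_inv_into_left[OF h that] .
  have k: "bij_betw k (pverts \<Gamma>) I" unfolding k_def by (rule bij_betw_inv_into[OF h])
  have finD: "finite D" by (simp add: D_def)
  define lift where "lift p = h \<circ> p \<circ> k" for p
  have lift_A: "lift p \<in> A" and lift_arc: "map_prod (lift p) (lift p) (map_prod h h x) = map_prod h h (map_prod p p x)"
    if p: "code_symmetry (length c div 2) L p" and x: "x \<in> set L" for p x
  proof -
    have "p ` I = I" using p unfolding code_symmetry_def I_def by simp
    then have "bij_betw p I I"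
      using eq_card_imp_inj_on[of I p] by (simp add: bij_betw_def I_def)
    then have bij: "bij_betw (lift p) (pverts \<Gamma>) (pverts \<Gamma>)"
      unfolding lift_def using k h by (blast intro: bij_betw_trans)
    have arc: "map_prod (lift p) (lift p) (map_prod h h y) = map_prod h h (map_prod p p y)"
      if "y \<in> set L" for y
      using kh LI that by (cases y) (simp add: lift_def)
    have "map_prod (lift p) (lift p) ` D \<subseteq> D"
    proof
      fix e assume "e \<in> map_prod (lift p) (lift p) ` D"
      then obtain y where y: "y \<in> set L" "e = map_prod (lift p) (lift p) (map_prod h h y)"
        by (auto simp: D_def)
      then have "e = map_prod h h (map_prod p p y)" by (simp only: arc)
      moreover have "map_prod p p y \<in> set L"
        using p y(1) unfolding code_symmetry_def by simp
      ultimately show "e \<in> D" unfolding D_def by (rule image_eqI)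
    qed
    moreover have "inj_on (map_prod (lift p) (lift p)) D"
    proof (rule inj_on_subset)
      show "inj_on (map_prod (lift p) (lift p)) (pverts \<Gamma> \<times> pverts \<Gamma>)"
        using bij_betw_imp_inj_on[OF bij] by (intro map_prod_inj_on)
      show "D \<subseteq> pverts \<Gamma> \<times> pverts \<Gamma>" using LI bij_betwE[OF h] by (auto simp: D_def)
    qed
    ultimately have "map_prod (lift p) (lift p) ` D = D"
      using endo_inj_surj[OF finD] by blast
    then show "lift p \<in> A" using bij by (simp add: A_def)
    show "map_prod (lift p) (lift p) (map_prod h h x) = map_prod h h (map_prod p p x)"
      by (rule arc[OF x])
  qed
  have A_comp: "f \<circ> g \<in> A" if "f \<in> A" "g \<in> A" for f g
  proof -
    have "map_prod (f \<circ> g) (f \<circ> g) ` D = map_prod f f ` map_prod g g ` D"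
      by (simp add: image_image map_prod_def split_def)
    then show ?thesis using that by (auto simp: A_def intro: bij_betw_trans)
  qed
  define d where "d = map_prod h h (hd L)"
  have "set L \<subseteq> {x \<in> set L. \<exists>f\<in>A. map_prod f f d = map_prod h h x}"
  proof (rule successively_closed[OF _ path(2)])
    \<comment> \<open>Membership in \<open>set L\<close> is added to the relation because
      \<open>lift_arc\<close> speaks only about elements of \<open>L\<close>.\<close>
    show "successively (\<lambda>d d'. d \<in> set L \<and> d' \<in> set L \<and> (d' = map_prod p p d \<or>
        d' = map_prod q q d)) L"
      using path(1) by (rule successively_cong[THEN iffD1, rotated 2]) auto
    have "id \<in> A" by (simp add: A_def map_prod.id)
    moreover have "map_prod id id d = map_prod h h (hd L)" by (simp add: d_def map_prod.id)
    ultimately show "hd L \<in> {x \<in> set L. \<exists>f\<in>A. map_prod f f d = map_prod h h x}"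
      using hd_in_set[OF path(2)] by blast
  next
    fix x y
    assume "x \<in> {x \<in> set L. \<exists>f\<in>A. map_prod f f d = map_prod h h x}"
      and xy: "x \<in> set L \<and> y \<in> set L \<and> (y = map_prod p p x \<or> y = map_prod q q x)"
    then obtain f where f: "f \<in> A" "map_prod f f d = map_prod h h x" by blast
    obtain r where r: "code_symmetry (length c div 2) L r" "y = map_prod r r x"
      using xy sym by blast
    have "map_prod (lift r \<circ> f) (lift r \<circ> f) d = map_prod (lift r) (lift r) (map_prod f f d)"
      by (cases d) simp
    also have "\<dots> = map_prod h h y"
      using lift_arc[OF r(1)] xy unfolding f(2) r(2) by blast
    finally show "y \<in> {x \<in> set L. \<exists>f\<in>A. map_prod f f d = map_prod h h x}"
      using A_comp[OF lift_A[OF r(1)] f(1)] xy by blast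
  qed
  then have reach: "\<exists>f\<in>A. map_prod f f d = map_prod h h x" if "x \<in> set L" for x
    using subsetD that by fastforce
  have trans: "\<exists>f. bij_betw f (pverts \<Gamma>) (pverts \<Gamma>) \<and> map_prod f f ` D = D \<and> map_prod f f d = e"
    if e: "e \<in> D" for e
  proof -
    obtain x where x: "e = map_prod h h x" "x \<in> set L"
      using e unfolding D_def by (rule imageE)
    obtain f where "f \<in> A" "map_prod f f d = e"
      using reach[OF x(2)] unfolding x(1)[symmetric] by (rule bexE)
    then show ?thesis unfolding A_def by blast
  qed
  have asym: "(v, u) \<notin> D" if uv: "(u, v) \<in> D" for u v
  proof -
    obtain i j where ij: "(i, j) \<in> set L" "u = h i" "v = h j" using uv by (auto simp: D_def)
    then have "(j, i) \<notin> set L" using L(2) by blast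
    then show ?thesis using hD LI[OF ij(1)] ij(2,3) by simp
  qed
  have tails: "fst ` D = pverts \<Gamma>"
  proof -
    have "fst ` D = h ` fst ` set L" by (simp add: D_def image_image)
    then show ?thesis using L(3) bij_betw_imp_surj_on[OF h] by (simp add: I_def)
  qed
  have "d \<in> D" using path(2) by (simp add: d_def D_def)
  note hat = half_arc_transitive_if_orientation[OF \<Gamma> Ds asym tails this trans]
  define w where "w = [(h v\<^sub>0, h v\<^sub>1), (h v\<^sub>1, h v\<^sub>2), (h v\<^sub>2, h v\<^sub>3), (h v\<^sub>3, h v\<^sub>4), (h v\<^sub>4, h v\<^sub>0)]"
  have vI: "v\<^sub>0 \<in> I" "v\<^sub>1 \<in> I" "v\<^sub>2 \<in> I" "v\<^sub>3 \<in> I" "v\<^sub>4 \<in> I"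
    using pattern(1) LI by auto
  have arcs: "(h v\<^sub>0, h v\<^sub>1) \<in> D" "(h v\<^sub>1, h v\<^sub>2) \<in> D" "(h v\<^sub>2, h v\<^sub>3) \<in> D" "(h v\<^sub>3, h v\<^sub>4) \<in> D"
    "(h v\<^sub>0, h v\<^sub>4) \<in> D"
    using pattern(1) vI hD by auto
  then have "set w \<subseteq> parcs \<Gamma>" unfolding Ds[symmetric] w_def by (auto simp: in_symcl_iff)
  then have "ucycle \<Gamma> w"
    using pattern(2) vI h_eq bij_betwE[OF h] unfolding ucycle_iff w_def by auto
  moreover have "\<not> directed_cycle D w"
  proof
    assume "directed_cycle D w"
    \<comment> \<open>The vertex \<open>h v\<^sub>0\<close> is the tail of two arcs of the
      orientation on this cycle.\<close>
    then have "\<exists>!a. a \<in> oriented_arcs D w \<and> fst a = h v\<^sub>0"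
      by (auto simp: directed_cycle_def w_def)
    moreover have "(h v\<^sub>0, h v\<^sub>1) \<in> oriented_arcs D w" "(h v\<^sub>0, h v\<^sub>4) \<in> oriented_arcs D w"
      using arcs by (auto simp: oriented_arcs_def in_symcl_iff w_def)
    ultimately have "h v\<^sub>1 = h v\<^sub>4" by auto
    then show False using h_eq vI pattern(2) by simp
  qed
  moreover have "length w = 5" by (simp add: w_def)
  ultimately show ?thesis using hat by blast
qed

section \<open>Codes and isomorphisms\<close>

lemma code_arcs_list: "code_arcs c = set (map (\<lambda>k. (k div 2, c ! k div 2)) [0..<length c])"
  by (auto simp: code_arcs_def)

text \<open>Concrete arc lists are compared arc by arc, each arc being matched in one direction or
  the other.\<close>

lemma symcl_eqI: "A \<subseteq> B\<^sup>s \<Longrightarrow> B \<subseteq> A\<^sup>s \<Longrightarrow> A\<^sup>s = B\<^sup>s"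
  unfolding set_eq_iff subset_iff split_paired_All in_symcl_iff by blast

lemma map_prod_inv_image:
  assumes "R \<subseteq> A \<times> A" "\<And>x. x \<in> A \<Longrightarrow> g (f x) = x"
  shows "map_prod g g ` map_prod f f ` R = R"
proof -
  have "map_prod g g (map_prod f f e) = e" if "e \<in> R" for e
    using subsetD[OF assms(1) that] assms(2) by (cases e) simp
  then show ?thesis by (force simp: image_image)
qed

lemma code_arcs_subset:
  assumes "\<forall>k\<in>set c. k < length c" "even (length c)"
  shows "code_arcs c \<subseteq> {..<length c div 2} \<times> {..<length c div 2}"
proof -
  have "k div 2 < length c div 2" if "k < length c" for k
    using that assms(2) by (auto elim!: evenE)
  then show ?thesis using assms(1) by (auto simp: code_arcs_def)
qed

lemma digraph_iso_if_coded:
  assumes \<Gamma>: "pair_graph \<Gamma>"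
    and range: "code_arcs c \<subseteq> {..<length c div 2} \<times> {..<length c div 2}"
    and c: "coded_by c (pverts \<Gamma>) (parcs \<Gamma>)" "coded_by c (pverts \<Delta>) (parcs \<Delta>)"
  shows "digraph_iso (with_proj \<Gamma>) (with_proj \<Delta>)"
proof -
  interpret pair_graph \<Gamma> by fact
  define I where "I = {..<length c div 2}"
  obtain h where h: "bij_betw h I (pverts \<Gamma>)" "parcs \<Gamma> = map_prod h h ` (code_arcs c)\<^sup>s"
    using c(1) unfolding coded_by_def I_def by blast
  obtain k where k: "bij_betw k I (pverts \<Delta>)" "parcs \<Delta> = map_prod k k ` (code_arcs c)\<^sup>s"
    using c(2) unfolding coded_by_def I_def by blast
  define f where "f = k \<circ> inv_into I h"
  have bij: "bij_betw f (pverts \<Gamma>) (pverts \<Delta>)"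
    unfolding f_def using bij_betw_trans[OF bij_betw_inv_into[OF h(1)] k(1)] .
  have "(code_arcs c)\<^sup>s \<subseteq> I \<times> I"
    using range by (auto simp: in_symcl_iff I_def)
  then have "map_prod (inv_into I h) (inv_into I h) ` parcs \<Gamma> = (code_arcs c)\<^sup>s"
    unfolding h(2) by (rule map_prod_inv_image) (rule bij_betw_inv_into_left[OF h(1)])
  then have parcs: "parcs \<Delta> = map_prod f f ` parcs \<Gamma>"
    unfolding k(2) f_def by (metis image_comp map_prod.comp)
  \<comment> \<open>Arcs are pairs of vertices, so the map on vertices induces the one on arcs, and
    the projections serve as tail and head.\<close>
  define iso where
    "iso = \<lparr>iso_verts = f, iso_arcs = map_prod f f, iso_head = snd, iso_tail = fst\<rparr>"
  have "inj_on (map_prod f f) (parcs \<Gamma>)"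
  proof (rule inj_on_subset)
    show "inj_on (map_prod f f) (pverts \<Gamma> \<times> pverts \<Gamma>)"
      using bij_betw_imp_inj_on[OF bij] by (intro map_prod_inj_on)
    show "parcs \<Gamma> \<subseteq> pverts \<Gamma> \<times> pverts \<Gamma>" using in_arcsD1 in_arcsD2 by auto
  qed
  then have "pre_digraph.digraph_isomorphism (with_proj \<Gamma>) iso"
    using bij_betw_imp_inj_on[OF bij] wf_digraph_wp_iff[of \<Gamma>] pair_wf_digraph
    by (simp add: pre_digraph.digraph_isomorphism_def iso_def)
  moreover have "with_proj \<Delta> = app_iso iso (with_proj \<Gamma>)"
    using bij_betw_imp_surj_on[OF bij] parcs by (simp add: with_proj_def app_iso_def iso_def)
  ultimately show ?thesis unfolding digraph_iso_def by blast
qed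

text \<open>An abstract isomorphism comes with its own map on arcs. As tail and head in the target
  are the projections, this map must act on pairs through the map on vertices, and the numbering can
  be pulled back.\<close>

lemma coded_if_digraph_iso:
  assumes \<Gamma>: "pair_graph \<Gamma>" and iso: "digraph_iso (with_proj \<Gamma>) (with_proj \<Delta>)"
    and c: "coded_by c (pverts \<Delta>) (parcs \<Delta>)"
  shows "coded_by c (pverts \<Gamma>) (parcs \<Gamma>)"
proof -
  interpret pair_graph \<Gamma> by fact
  obtain iso where iso: "pre_digraph.digraph_isomorphism (with_proj \<Gamma>) iso"
    and \<Delta>: "with_proj \<Delta> = app_iso iso (with_proj \<Gamma>)"
    using iso unfolding digraph_iso_def by blast
  define f where "f = iso_verts iso"
  have "verts (with_proj \<Delta>) = f ` pverts \<Gamma>" "arcs (with_proj \<Delta>) = iso_arcs iso ` parcs \<Gamma>"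
    "tail (with_proj \<Delta>) = iso_tail iso" "head (with_proj \<Delta>) = iso_head iso"
    unfolding \<Delta> by (simp_all add: f_def)
  then have \<Delta>': "pverts \<Delta> = f ` pverts \<Gamma>" "parcs \<Delta> = iso_arcs iso ` parcs \<Gamma>"
    "iso_tail iso = fst" "iso_head iso = snd"
    by simp_all
  have arc: "iso_arcs iso e = map_prod f f e" if "e \<in> parcs \<Gamma>" for e
    using iso that unfolding pre_digraph.digraph_isomorphism_def with_proj_simps \<Delta>'(3,4)
    by (auto simp: f_def prod_eq_iff)
  have inj: "inj_on f (pverts \<Gamma>)"
    using iso unfolding pre_digraph.digraph_isomorphism_def by (simp add: f_def)
  then have bij: "bij_betw f (pverts \<Gamma>) (pverts \<Delta>)" by (simp add: bij_betw_def \<Delta>'(1))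
  have parcs: "parcs \<Delta> = map_prod f f ` parcs \<Gamma>"
    unfolding \<Delta>'(2) using arc by (intro image_cong) auto
  obtain k where k: "bij_betw k {..<length c div 2} (pverts \<Delta>)"
      "parcs \<Delta> = map_prod k k ` (code_arcs c)\<^sup>s"
    using c unfolding coded_by_def by blast
  define g where "g = inv_into (pverts \<Gamma>) f"
  have "map_prod g g ` map_prod f f ` parcs \<Gamma> = parcs \<Gamma>"
    using in_arcsD1 in_arcsD2 bij_betw_inv_into_left[OF bij]
    by (intro map_prod_inv_image[of _ "pverts \<Gamma>"]) (auto simp: g_def)
  then have "parcs \<Gamma> = map_prod (g \<circ> k) (g \<circ> k) ` (code_arcs c)\<^sup>s"
    unfolding parcs[symmetric] k(2) by (metis image_comp map_prod.comp)
  moreover have "bij_betw (g \<circ> k) {..<length c div 2} (pverts \<Gamma>)"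
    unfolding g_def using bij_betw_trans[OF k(1) bij_betw_inv_into[OF bij]] .
  ultimately show ?thesis unfolding coded_by_def by blast
qed

section \<open>The Doyle-Holt graph\<close>

text \<open>
  The arcs of the code, listed along a walk in which each arc is the image of its predecessor under one of
  the two symmetries defined next.
\<close>

definition holt_arcs :: "(nat \<times> nat) list" where
  "holt_arcs =
    [(0, 20), (1, 21), (2, 22), (3, 23), (4, 24), (5, 25), (6, 26), (7, 18), (8, 19), (13, 5), (14,
    6), (15, 7), (16, 8), (17, 0), (9, 1), (10, 2), (11, 3), (12, 4), (24, 11), (25, 12), (26, 13),
    (18, 14), (19, 15), (20, 16), (21, 17), (22, 9), (23, 10), (7, 23), (8, 24), (0, 25), (1, 26),
    (2, 18), (3, 19), (4, 20), (5, 21), (6, 22), (12, 2), (13, 3), (14, 4), (15, 5), (16, 6), (17,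
    7), (9, 8), (10, 0), (11, 1), (19, 14), (20, 15), (21, 16), (22, 17), (23, 9), (24, 10), (25,
    11), (26, 12), (18, 13)]"

definition holt_sym1 :: "nat \<Rightarrow> nat" where
  "holt_sym1 i = 9 * (i div 9) + (i + 1) mod 9"

text \<open>In terms of pairs this takes \<open>(i, j)\<close> to \<open>(i + 1, -4 * j)\<close>.
  With the factor -4 instead of 4 its cube is the map negating \<open>j\<close>, which exchanges the
  two arcs leaving \<open>(0, 0)\<close>.\<close>

definition holt_sym2 :: "nat \<Rightarrow> nat" where
  "holt_sym2 i = (9 * (i div 9) + 9) mod 27 + 5 * i mod 9"

lemma code_arcs_holt: "code_arcs holt_code = set holt_arcs"
proof
  show "code_arcs holt_code \<subseteq> set holt_arcs"
    unfolding code_arcs_list holt_code_def holt_arcs_def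
    by (simp add: upt_rec_numeral)
  show "set holt_arcs \<subseteq> code_arcs holt_code"
    unfolding code_arcs_list holt_code_def holt_arcs_def
    by (simp add: upt_rec_numeral)
qed

lemma length_holt_code: "length holt_code = 54"
  by (simp add: holt_code_def)

lemma asym_holt: "\<forall>(i, j)\<in>set holt_arcs. (j, i) \<notin> set holt_arcs"
  unfolding holt_arcs_def by simp

lemma range_holt: "fst ` set holt_arcs = {..<27}" "snd ` set holt_arcs \<subseteq> {..<27}"
proof -
  show "fst ` set holt_arcs = {..<27}"
    unfolding holt_arcs_def by (auto simp: lessThan_nat_numeral)
  show "snd ` set holt_arcs \<subseteq> {..<27}"
    unfolding holt_arcs_def by simp
qed

lemma sym_holt: "code_symmetry 27 holt_arcs holt_sym1" "code_symmetry 27 holt_arcs holt_sym2"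
proof -
  \<comment> \<open>\<open>S\<close> stays folded, so that each image is looked up among the facts
    \<open>mem\<close> instead of unfolding membership into a long disjunction.\<close>
  define S where "S = set holt_arcs"
  have "list_all (\<lambda>d. d \<in> S) holt_arcs" by (simp add: S_def list_all_iff)
  note mem = this[unfolded holt_arcs_def list.pred_inject]
  have "list_all (\<lambda>d. map_prod holt_sym1 holt_sym1 d \<in> S) holt_arcs"
    using mem unfolding holt_arcs_def list.pred_inject map_prod_simp holt_sym1_def by (simp, simp add: numeral_2_eq_2)
  moreover have "list_all (\<lambda>d. map_prod holt_sym2 holt_sym2 d \<in> S) holt_arcs"
    using mem unfolding holt_arcs_def list.pred_inject map_prod_simp holt_sym2_def by (simp, simp add: numeral_2_eq_2)
  moreover have "holt_sym1 ` {..<27} = {..<27}" "holt_sym2 ` {..<27} = {..<27}"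
    by (intro equalityI; simp add: lessThan_nat_numeral lessThan_Suc holt_sym1_def holt_sym2_def)+
  ultimately show "code_symmetry 27 holt_arcs holt_sym1" "code_symmetry 27 holt_arcs holt_sym2"
    unfolding code_symmetry_def list_all_iff S_def by blast+
qed

lemma path_holt: "successively (\<lambda>d d'. d' = map_prod holt_sym1 holt_sym1 d \<or>
     d' = map_prod holt_sym2 holt_sym2 d) holt_arcs"
  unfolding holt_arcs_def successively.simps map_prod_simp prod.inject
  by (simp add: holt_sym1_def holt_sym2_def)

lemma coded_holt: "coded_by holt_code (pverts (X_o 3 9 4)) (parcs (X_o 3 9 4))"
proof -
  define h where "h i = (i div 9, int (i mod 9))" for i :: nat
  have int9: "{0..<9::int} = {0, 1, 2, 3, 4, 5, 6, 7, 8}" by auto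
  have nat3: "{0..<3::nat} = {0, 1, 2}" by auto
  have "bij_betw h {..<27} ({0..<3} \<times> {0..<9})"
  proof (rule bij_betw_byWitness[where f' = "\<lambda>(i, j). 9 * i + nat j"])
  qed (auto simp: h_def)
  moreover have "map_prod h h ` (set holt_arcs)\<^sup>s = parcs (X_o 3 9 4)"
    unfolding map_prod_symcl X_o_def pair_pre_digraph.select_convs
  proof (rule symcl_eqI)
    show "map_prod h h ` set holt_arcs \<subseteq> (\<Union>i\<in>{0..<3}. \<Union>j\<in>{0..<9}.
        {((i, j), (Suc i mod 3, (j + 4 ^ i) mod 9)), ((i, j), (Suc i mod 3, (j - 4 ^ i) mod 9))})\<^sup>s"
      unfolding holt_arcs_def int9 nat3 by (simp add: h_def in_symcl_iff)
    show "(\<Union>i\<in>{0..<3}. \<Union>j\<in>{0..<9}.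
        {((i, j), (Suc i mod 3, (j + 4 ^ i) mod 9)), ((i, j), (Suc i mod 3, (j - 4 ^ i) mod 9))})
        \<subseteq> (map_prod h h ` set holt_arcs)\<^sup>s"
      unfolding holt_arcs_def int9 nat3 by (simp add: h_def in_symcl_iff)
  qed
  ultimately show ?thesis
    unfolding coded_by_def code_arcs_holt by (intro exI[of _ h]) (simp add: X_o_def length_holt_code)
qed

section \<open>The Rose window graph\<close>

definition rose41_arcs :: "(nat \<times> nat) list" where
  "rose41_arcs =
    [(0, 19), (1, 20), (2, 21), (3, 22), (4, 23), (5, 12), (6, 13), (7, 14), (8, 15), (9, 16), (10,
    17), (11, 18), (21, 9), (22, 10), (23, 11), (12, 0), (3, 2), (4, 3), (5, 4), (6, 5), (7, 6), (8,
    7), (18, 20), (19, 21), (20, 22), (21, 23), (22, 12), (23, 13), (19, 7), (20, 8), (16, 18), (17,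
    19), (13, 1), (14, 2), (15, 3), (16, 4), (17, 5), (18, 6), (9, 8), (10, 9), (11, 10), (0, 11),
    (1, 0), (2, 1), (12, 14), (13, 15), (14, 16), (15, 17)]"

definition rose41_sym1 :: "nat \<Rightarrow> nat" where
  "rose41_sym1 i = 12 * (i div 12) + (i + 1) mod 12"

text \<open>The rotation \<open>rose41_sym1\<close> has four orbits on the arcs: from x_i to
  y_(i+7), from y_i to x_i, from x_i to x_(i-1), and from y_i to y_(i+2). This automorphism mixes
  the two kinds of vertices and fuses the four orbits.\<close>

definition rose41_sym2 :: "nat \<Rightarrow> nat" where
  "rose41_sym2 i = (if i < 12
     then if i mod 3 = 0 then (i + 2) mod 12
       else if i mod 3 = 1 then 12 + (i + 1) mod 12 else 12 + (i + 10) mod 12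
     else if i mod 3 = 0 then (i + 3) mod 12
       else if i mod 3 = 1 then (i + 6) mod 12 else 12 + (i + 8) mod 12)"

lemma code_arcs_rose41: "code_arcs rose41_code = set rose41_arcs"
proof
  show "code_arcs rose41_code \<subseteq> set rose41_arcs"
    unfolding code_arcs_list rose41_code_def rose41_arcs_def
    by (simp add: upt_rec_numeral)
  show "set rose41_arcs \<subseteq> code_arcs rose41_code"
    unfolding code_arcs_list rose41_code_def rose41_arcs_def
    by (simp add: upt_rec_numeral)
qed

lemma length_rose41_code: "length rose41_code = 48"
  by (simp add: rose41_code_def)

lemma asym_rose41: "\<forall>(i, j)\<in>set rose41_arcs. (j, i) \<notin> set rose41_arcs"
  unfolding rose41_arcs_def by simp

lemma range_rose41: "fst ` set rose41_arcs = {..<24}" "snd ` set rose41_arcs \<subseteq> {..<24}"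
proof -
  show "fst ` set rose41_arcs = {..<24}"
    unfolding rose41_arcs_def by (auto simp: lessThan_nat_numeral)
  show "snd ` set rose41_arcs \<subseteq> {..<24}"
    unfolding rose41_arcs_def by simp
qed

lemma sym_rose41: "code_symmetry 24 rose41_arcs rose41_sym1" "code_symmetry 24 rose41_arcs rose41_sym2"
proof -
  define S where "S = set rose41_arcs"
  have "list_all (\<lambda>d. d \<in> S) rose41_arcs" by (simp add: S_def list_all_iff)
  note mem = this[unfolded rose41_arcs_def list.pred_inject]
  have "list_all (\<lambda>d. map_prod rose41_sym1 rose41_sym1 d \<in> S) rose41_arcs"
    using mem unfolding rose41_arcs_def list.pred_inject map_prod_simp rose41_sym1_def by (simp, simp add: numeral_2_eq_2)
  moreover have "list_all (\<lambda>d. map_prod rose41_sym2 rose41_sym2 d \<in> S) rose41_arcs"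
    using mem unfolding rose41_arcs_def list.pred_inject map_prod_simp rose41_sym2_def by (simp, simp add: numeral_2_eq_2)
  moreover have "rose41_sym1 ` {..<24} = {..<24}" "rose41_sym2 ` {..<24} = {..<24}"
    by (intro equalityI; simp add: lessThan_nat_numeral lessThan_Suc rose41_sym1_def rose41_sym2_def)+
  ultimately show "code_symmetry 24 rose41_arcs rose41_sym1" "code_symmetry 24 rose41_arcs rose41_sym2"
    unfolding code_symmetry_def list_all_iff S_def by blast+
qed

lemma path_rose41: "successively (\<lambda>d d'. d' = map_prod rose41_sym1 rose41_sym1 d \<or>
     d' = map_prod rose41_sym2 rose41_sym2 d) rose41_arcs"
  unfolding rose41_arcs_def successively.simps map_prod_simp prod.inject
  by (simp add: rose41_sym1_def rose41_sym2_def)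

lemma int12: "{0..<12::int} = {0, 1, 2, 3, 4, 5, 6, 7, 8, 9, 10, 11}"
  unfolding set_eq_iff atLeastLessThan_iff insert_iff empty_iff by presburger

definition rose_number :: "nat \<Rightarrow> rose_vertex" where
  "rose_number i = (if i < 12 then Rose_x (int i) else Rose_y (int i - 12))"

lemma bij_rose_number: "bij_betw rose_number {..<24} (Rose_x ` {0..<12} \<union> Rose_y ` {0..<12})"
  by (rule bij_betw_byWitness[where f' = "case_rose_vertex nat (\<lambda>i. nat i + 12)"])
    (auto simp: rose_number_def)

lemma coded_rose_if_arcs:
  assumes "length c = 48"
    and "map_prod rose_number rose_number ` code_arcs c \<subseteq> parcs (rose_window 12 5 2)"
    and "(\<Union>i\<in>{0..<12}. {(Rose_x i, Rose_x ((i + 1) mod 12)), (Rose_y i, Rose_y ((i + 2) mod 12)),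
      (Rose_x i, Rose_y i), (Rose_x i, Rose_y ((i - 5) mod 12))})
      \<subseteq> (map_prod rose_number rose_number ` code_arcs c)\<^sup>s"
  shows "coded_by c (pverts (rose_window 12 5 2)) (parcs (rose_window 12 5 2))"
proof -
  have "map_prod rose_number rose_number ` (code_arcs c)\<^sup>s = parcs (rose_window 12 5 2)"
    using assms(2,3) unfolding map_prod_symcl rose_window_def pair_pre_digraph.select_convs
    by (rule symcl_eqI)
  then show ?thesis
    unfolding coded_by_def using bij_rose_number assms(1)
    by (intro exI[of _ rose_number]) (simp add: rose_window_def)
qed

lemma coded_rose41: "coded_by rose41_code (pverts (rose_window 12 5 2)) (parcs (rose_window 12 5 2))"
proof (rule coded_rose_if_arcs)
  show "map_prod rose_number rose_number ` code_arcs rose41_code \<subseteq> parcs (rose_window 12 5 2)"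
    unfolding code_arcs_rose41 rose41_arcs_def rose_window_def pair_pre_digraph.select_convs int12
    by (simp add: rose_number_def in_symcl_iff)
  show "(\<Union>i\<in>{0..<12}. {(Rose_x i, Rose_x ((i + 1) mod 12)), (Rose_y i, Rose_y ((i + 2) mod 12)),
      (Rose_x i, Rose_y i), (Rose_x i, Rose_y ((i - 5) mod 12))})
      \<subseteq> (map_prod rose_number rose_number ` code_arcs rose41_code)\<^sup>s"
    unfolding code_arcs_rose41 rose41_arcs_def int12
    by (simp add: rose_number_def in_symcl_iff)
qed (rule length_rose41_code)

text \<open>This list serves only to recognise the graph, so it is sorted by tails; the
  half-arc-transitive group on the Rose window graph comes from \<open>rose41_code\<close>.\<close>

definition rose32_arcs :: "(nat \<times> nat) list" where
  "rose32_arcs = 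
     [(0, 19), (0, 12), (1, 0), (1, 2), (2, 14), (2, 21), (3, 2), (3, 4), (4, 23), (4, 16), (5,
      6), (5, 4), (6, 13), (6, 18), (7, 6), (7, 8), (8, 20), (8, 15), (9, 8), (9, 10), (10, 17),
      (10, 22), (11, 0), (11, 10), (12, 5), (12, 14), (13, 1), (13, 23), (14, 7), (14, 16), (15,
      13), (15, 3), (16, 18), (16, 9), (17, 15), (17, 5), (18, 11), (18, 20), (19, 7), (19, 17),
      (20, 1), (20, 22), (21, 19), (21, 9), (22, 12), (22, 3), (23, 11), (23, 21)]"

lemma code_arcs_rose32: "code_arcs rose32_code = set rose32_arcs"
proof
  show "code_arcs rose32_code \<subseteq> set rose32_arcs"
    unfolding code_arcs_list rose32_code_def rose32_arcs_def
    by (simp add: upt_rec_numeral)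
  show "set rose32_arcs \<subseteq> code_arcs rose32_code"
    unfolding code_arcs_list rose32_code_def rose32_arcs_def
    by (simp add: upt_rec_numeral)
qed

lemma length_rose32_code: "length rose32_code = 48"
  by (simp add: rose32_code_def)

lemma coded_rose32: "coded_by rose32_code (pverts (rose_window 12 5 2)) (parcs (rose_window 12 5 2))"
proof (rule coded_rose_if_arcs)
  show "map_prod rose_number rose_number ` code_arcs rose32_code \<subseteq> parcs (rose_window 12 5 2)"
    unfolding code_arcs_rose32 rose32_arcs_def rose_window_def pair_pre_digraph.select_convs int12
    by (simp add: rose_number_def in_symcl_iff)
  show "(\<Union>i\<in>{0..<12}. {(Rose_x i, Rose_x ((i + 1) mod 12)), (Rose_y i, Rose_y ((i + 2) mod 12)),
      (Rose_x i, Rose_y i), (Rose_x i, Rose_y ((i - 5) mod 12))})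
      \<subseteq> (map_prod rose_number rose_number ` code_arcs rose32_code)\<^sup>s"
    unfolding code_arcs_rose32 rose32_arcs_def int12
    by (simp add: rose_number_def in_symcl_iff)
qed (rule length_rose32_code)

lemma code_ranges:
  "code_arcs holt_code \<subseteq> {..<length holt_code div 2} \<times> {..<length holt_code div 2}"
  "code_arcs rose41_code \<subseteq> {..<length rose41_code div 2} \<times> {..<length rose41_code div 2}"
  "code_arcs rose32_code \<subseteq> {..<length rose32_code div 2} \<times> {..<length rose32_code div 2}"
  by (rule code_arcs_subset; simp add: holt_code_def rose41_code_def rose32_code_def)+

theorem theorem5p5:
  fixes \<Gamma> :: "'a pair_pre_digraph"
  assumes "pair_graph \<Gamma>"
    and "Digraph_Component.connected (with_proj \<Gamma>)"
    and "tetravalent \<Gamma>"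
    and "girth \<Gamma> = 5"
  shows "(\<exists>G D p. half_arc_transitive \<Gamma> G \<and> induced_orientation \<Gamma> G D \<and>
              ucycle \<Gamma> p \<and> length p = 5 \<and> \<not> directed_cycle D p) \<longleftrightarrow>
         digraph_iso (with_proj \<Gamma>) (with_proj (X_o 3 9 4)) \<or>
         digraph_iso (with_proj \<Gamma>) (with_proj (rose_window 12 5 2))"
proof
  assume "\<exists>G D p. half_arc_transitive \<Gamma> G \<and> induced_orientation \<Gamma> G D \<and>
    ucycle \<Gamma> p \<and> length p = 5 \<and> \<not> directed_cycle D p"
  then obtain G D p where "half_arc_transitive \<Gamma> G" "induced_orientation \<Gamma> G D"
    "ucycle \<Gamma> p" "length p = 5" "\<not> directed_cycle D p"
    by blast
  from classified_if_undirected[OF assms this]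
  show "digraph_iso (with_proj \<Gamma>) (with_proj (X_o 3 9 4)) \<or>
    digraph_iso (with_proj \<Gamma>) (with_proj (rose_window 12 5 2))"
    using digraph_iso_if_coded[OF assms(1) code_ranges(1) _ coded_holt]
      digraph_iso_if_coded[OF assms(1) code_ranges(2) _ coded_rose41]
      digraph_iso_if_coded[OF assms(1) code_ranges(3) _ coded_rose32]
    by blast
next
  assume "digraph_iso (with_proj \<Gamma>) (with_proj (X_o 3 9 4)) \<or>
    digraph_iso (with_proj \<Gamma>) (with_proj (rose_window 12 5 2))"
  then show "\<exists>G D p. half_arc_transitive \<Gamma> G \<and> induced_orientation \<Gamma> G D \<and>
    ucycle \<Gamma> p \<and> length p = 5 \<and> \<not> directed_cycle D p"
  proof
    assume "digraph_iso (with_proj \<Gamma>) (with_proj (X_o 3 9 4))"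
    then have coded: "coded_by holt_code (pverts \<Gamma>) (parcs \<Gamma>)"
      using coded_if_digraph_iso[OF assms(1) _ coded_holt] by blast
    \<comment> \<open>The arcs 0, 20, 15, 5, 25 form a directed path of length 4, closed by the arc
      from 0 to 25.\<close>
    show ?thesis
      by (rule undirected_pentagon_if_coded[OF assms(1) coded code_arcs_holt[symmetric] asym_holt
            _ _ _ _ path_holt, of 0 20 15 5 25])
        (simp_all add: length_holt_code range_holt sym_holt, simp_all add: holt_arcs_def)
  next
    assume "digraph_iso (with_proj \<Gamma>) (with_proj (rose_window 12 5 2))"
    then have coded: "coded_by rose41_code (pverts \<Gamma>) (parcs \<Gamma>)"
      using coded_if_digraph_iso[OF assms(1) _ coded_rose41] by blast
    \<comment> \<open>The pentagon is the directed path x_0, y_7, y_9, y_11, x_11 together with the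
      arc from x_0 to x_11.\<close>
    show ?thesis
      by (rule undirected_pentagon_if_coded[OF assms(1) coded code_arcs_rose41[symmetric] asym_rose41
            _ _ _ _ path_rose41, of 0 19 21 23 11])
        (simp_all add: length_rose41_code range_rose41 sym_rose41, simp_all add: rose41_arcs_def)
  qed
qed

end
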